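(* Let $\lambda\in\mathbb{C}$ and $k,p\in L^1(\mathbb{R}^N)$, and consider the convolution equation $$\lambda\phi(\boldsymbol{x})+(k\odot\phi)(\boldsymbol{x})=p(\boldsymbol{x})\qquad(\text{a.e. }\boldsymbol{x}\in\mathbb{R}^N)$$ for an unknown function $\phi$, where $(\odot,\mathcal{Q},\Omega)$ is either of the two triples (convolution, transform, factor) described in the context. Put $S(\boldsymbol{\omega})=\lambda+\Omega(\boldsymbol{\omega})(\mathcal{Q}k)(\boldsymbol{\omega})$. Assume that $S(\boldsymbol{\omega})\neq 0$ for every $\boldsymbol{\omega}\in\mathbb{R}^N$ and that $\frac{\mathcal{Q}p}{S}\in L^1(\mathbb{R}^N)$. Then the equation has a solution $\phi\in L^1(\mathbb{R}^N)$ if and only if $$\mathcal{Q}^{-1}\Big(\frac{\mathcal{Q}p}{S}\Big)\in L^1(\mathbb{R}^N).$$ Moreover, if this condition holds, then the solution is given explicitly by $\phi=\mathcal{Q}^{-1}\big(\frac{\mathcal{Q}p}{S}\big)\in L^1(\mathbb{R}^N)$.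
   Context: Let $N\ge 1$ and $\boldsymbol{\Lambda}=(\Lambda_1,\dots,\Lambda_N)$ with $\Lambda_j=(a_j,b_j,c_j,d_j,e_j)\in\mathbb{R}^5$ and $b_j\neq 0$ for $j=1,\dots,N$. All square roots are principal. The multidimensional QPFT of $f\in L^1(\mathbb{R}^N)$ is $(\mathcal{Q}_{\boldsymbol{\Lambda}}f)(\boldsymbol{\omega})=\int_{\mathbb{R}^N}\mathcal{K}_{\boldsymbol{\Lambda}}(\boldsymbol{\omega},\boldsymbol{x})f(\boldsymbol{x})\,d\boldsymbol{x}$ with $$\mathcal{K}_{\boldsymbol{\Lambda}}(\boldsymbol{\omega},\boldsymbol{x})=\prod_{j=1}^N\sqrt{\tfrac{b_j}{2\pi i}}\;e^{i(a_jx_j^2+b_jx_j\omega_j+c_j\omega_j^2+d_jx_j+e_j\omega_j)},$$ and the inverse transform of $F\in L^1(\mathbb{R}^N)$ is $$(\mathcal{Q}_{\boldsymbol{\Lambda}}^{-1}F)(\boldsymbol{x})=\int_{\mathbb{R}^N}\Big(\prod_{j=1}^N\sqrt{\tfrac{b_ji}{2\pi}}\;e^{-i(a_jx_j^2+b_jx_j\omega_j+c_j\omega_j^2+d_jx_j+e_j\omega_j)}\Big)F(\boldsymbol{\omega})\,d\boldsymbol{\omega}.$$ Put $(u\star v)(\boldsymbol{x})=\frac{1}{(\sqrt{2\pi})^N}\int_{\mathbb{R}^N}u(\boldsymbol{\tau})v(\boldsymbol{x}-\boldsymbol{\tau})\,d\boldsymbol{\tau}$ and $C_{\boldsymbol{\Lambda}}=\prod_{j=1}^N\sqrt{b_j/i}$.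 The two admissible triples are: (1) $\odot=\otimes$ with $(f\otimes g)(\boldsymbol{x})=C_{\boldsymbol{\Lambda}}\,e^{-i\sum_ja_jx_j^2}\big((f\phi_0)\star(g\phi_0)\big)(\boldsymbol{x})$, $\phi_0(\boldsymbol{y})=e^{i\sum_ja_jy_j^2}$; $\mathcal{Q}=\mathcal{Q}_{\boldsymbol{\Lambda}}$; $\Omega(\boldsymbol{\omega})=e^{-i\sum_j(c_j\omega_j^2+e_j\omega_j)}$. (2) For a fixed $\mu\in\mathbb{R}\setminus\{0\}$, $\odot=\otimes_{\boldsymbol{\Lambda},\mu}$ with $(f\otimes_{\boldsymbol{\Lambda},\mu}g)(\boldsymbol{x})=|\mu|^NC_{\boldsymbol{\Lambda}}\,\psi(\boldsymbol{x})^{-1}\big((f\psi)\star(g\psi)\big)(\boldsymbol{x})$, $\psi(\boldsymbol{y})=e^{i\mu^2\sum_j(a_jy_j^2+d_jy_j)}$; $\mathcal{Q}=\mathcal{Q}_{\boldsymbol{\Lambda}'}$ where $\boldsymbol{\Lambda}'$ has components $\Lambda_j'=(\mu^2a_j,\mu^2b_j,\mu^2c_j,\mu^2d_j,\mu^2e_j)$; $\Omega(\boldsymbol{\omega})=e^{-i\mu^2\sum_j(c_j\omega_j^2+e_j\omega_j)}$. *)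

theory Defs
  imports "HOL-Analysis.Analysis"
begin

text \<open>A parameter \<open>(a, b, c, d, e) \<in> \<real>\<^sup>5\<close>; a multi-parameter is a function from the coordinate
  index type \<open>'n\<close> (so that \<open>N = CARD('n)\<close>) to such quintuples.\<close>

record qp_param =
  pa :: real
  pb :: real
  pc :: real
  pd :: real
  pe :: real

definition scale_param :: "real \<Rightarrow> ('n \<Rightarrow> qp_param) \<Rightarrow> 'n \<Rightarrow> qp_param" where
  "scale_param s \<Lambda> j =
     \<lparr>pa = s * pa (\<Lambda> j), pb = s * pb (\<Lambda> j), pc = s * pc (\<Lambda> j), pd = s * pd (\<Lambda> j), pe = s * pe (\<Lambda> j)\<rparr>"

definition qp_phase :: "qp_param \<Rightarrow> real \<Rightarrow> real \<Rightarrow> real" where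
  "qp_phase P w x = pa P * x\<^sup>2 + pb P * x * w + pc P * w\<^sup>2 + pd P * x + pe P * w"

definition qp_kernel :: "('n::finite \<Rightarrow> qp_param) \<Rightarrow> real^'n \<Rightarrow> real^'n \<Rightarrow> complex" where
  "qp_kernel \<Lambda> \<omega> x =
     (\<Prod>j\<in>UNIV. csqrt (of_real (pb (\<Lambda> j)) / (2 * of_real pi * \<i>))
                 * exp (\<i> * of_real (qp_phase (\<Lambda> j) (\<omega> $ j) (x $ j))))"

definition qp_inv_kernel :: "('n::finite \<Rightarrow> qp_param) \<Rightarrow> real^'n \<Rightarrow> real^'n \<Rightarrow> complex" where
  "qp_inv_kernel \<Lambda> \<omega> x =
     (\<Prod>j\<in>UNIV. csqrt (of_real (pb (\<Lambda> j)) * \<i> / (2 * of_real pi))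
                 * exp (- \<i> * of_real (qp_phase (\<Lambda> j) (\<omega> $ j) (x $ j))))"

definition qpft :: "('n::finite \<Rightarrow> qp_param) \<Rightarrow> (real^'n \<Rightarrow> complex) \<Rightarrow> real^'n \<Rightarrow> complex" where
  "qpft \<Lambda> f \<omega> = (LINT x|lebesgue. qp_kernel \<Lambda> \<omega> x * f x)"

definition inv_qpft :: "('n::finite \<Rightarrow> qp_param) \<Rightarrow> (real^'n \<Rightarrow> complex) \<Rightarrow> real^'n \<Rightarrow> complex" where
  "inv_qpft \<Lambda> F x = (LINT \<omega>|lebesgue. qp_inv_kernel \<Lambda> \<omega> x * F \<omega>)"

definition star_conv ::
  "(real^'n::finite \<Rightarrow> complex) \<Rightarrow> (real^'n \<Rightarrow> complex) \<Rightarrow> real^'n \<Rightarrow> complex" where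
  "star_conv u v x =
     1 / (of_real (sqrt (2 * pi))) ^ CARD('n) * (LINT \<tau>|lebesgue. u \<tau> * v (x - \<tau>))"

definition C_const :: "('n::finite \<Rightarrow> qp_param) \<Rightarrow> complex" where
  "C_const \<Lambda> = (\<Prod>j\<in>UNIV. csqrt (of_real (pb (\<Lambda> j)) / \<i>))"

definition chirp :: "('n::finite \<Rightarrow> qp_param) \<Rightarrow> real^'n \<Rightarrow> complex" where
  "chirp \<Lambda> y = exp (\<i> * of_real (\<Sum>j\<in>UNIV. pa (\<Lambda> j) * (y $ j)\<^sup>2))"

definition otimes_conv ::
  "('n::finite \<Rightarrow> qp_param) \<Rightarrow> (real^'n \<Rightarrow> complex) \<Rightarrow> (real^'n \<Rightarrow> complex) \<Rightarrow> real^'n \<Rightarrow> complex" where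
  "otimes_conv \<Lambda> f g x =
     C_const \<Lambda> * exp (- \<i> * of_real (\<Sum>j\<in>UNIV. pa (\<Lambda> j) * (x $ j)\<^sup>2))
       * star_conv (\<lambda>y. f y * chirp \<Lambda> y) (\<lambda>y. g y * chirp \<Lambda> y) x"

definition mu_chirp :: "('n::finite \<Rightarrow> qp_param) \<Rightarrow> real \<Rightarrow> real^'n \<Rightarrow> complex" where
  "mu_chirp \<Lambda> \<mu> y =
     exp (\<i> * of_real (\<mu>\<^sup>2 * (\<Sum>j\<in>UNIV. pa (\<Lambda> j) * (y $ j)\<^sup>2 + pd (\<Lambda> j) * y $ j)))"

definition otimes_mu_conv ::
  "('n::finite \<Rightarrow> qp_param) \<Rightarrow> real \<Rightarrow> (real^'n \<Rightarrow> complex) \<Rightarrow> (real^'n \<Rightarrow> complex) \<Rightarrow> real^'n \<Rightarrow> complex" where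
  "otimes_mu_conv \<Lambda> \<mu> f g x =
     of_real (\<bar>\<mu>\<bar> ^ CARD('n)) * C_const \<Lambda> * inverse (mu_chirp \<Lambda> \<mu> x)
       * star_conv (\<lambda>y. f y * mu_chirp \<Lambda> \<mu> y) (\<lambda>y. g y * mu_chirp \<Lambda> \<mu> y) x"

definition omega_factor :: "('n::finite \<Rightarrow> qp_param) \<Rightarrow> real^'n \<Rightarrow> complex" where
  "omega_factor \<Lambda> \<omega> =
     exp (- \<i> * of_real (\<Sum>j\<in>UNIV. pc (\<Lambda> j) * (\<omega> $ j)\<^sup>2 + pe (\<Lambda> j) * \<omega> $ j))"

definition omega_mu_factor :: "('n::finite \<Rightarrow> qp_param) \<Rightarrow> real \<Rightarrow> real^'n \<Rightarrow> complex" where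
  "omega_mu_factor \<Lambda> \<mu> \<omega> =
     exp (- \<i> * of_real (\<mu>\<^sup>2 * (\<Sum>j\<in>UNIV. pc (\<Lambda> j) * (\<omega> $ j)\<^sup>2 + pe (\<Lambda> j) * \<omega> $ j)))"

text \<open>The two admissible triples (convolution, transform, factor). The inverse transform belonging
  to the transform is carried along as an extra component.\<close>

definition admissible ::
  "('n::finite \<Rightarrow> qp_param)
    \<Rightarrow> ((real^'n \<Rightarrow> complex) \<Rightarrow> (real^'n \<Rightarrow> complex) \<Rightarrow> real^'n \<Rightarrow> complex)
    \<Rightarrow> ((real^'n \<Rightarrow> complex) \<Rightarrow> real^'n \<Rightarrow> complex)
    \<Rightarrow> ((real^'n \<Rightarrow> complex) \<Rightarrow> real^'n \<Rightarrow> complex)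
    \<Rightarrow> (real^'n \<Rightarrow> complex) \<Rightarrow> bool" where
  "admissible \<Lambda> conv Q Qinv \<Omega> \<longleftrightarrow>
     (conv = otimes_conv \<Lambda> \<and> Q = qpft \<Lambda> \<and> Qinv = inv_qpft \<Lambda> \<and> \<Omega> = omega_factor \<Lambda>) \<or>
     (\<exists>\<mu>. \<mu> \<noteq> 0 \<and> conv = otimes_mu_conv \<Lambda> \<mu>
        \<and> Q = qpft (scale_param (\<mu>\<^sup>2) \<Lambda>) \<and> Qinv = inv_qpft (scale_param (\<mu>\<^sup>2) \<Lambda>)
        \<and> \<Omega> = omega_mu_factor \<Lambda> \<mu>)"

text \<open>Elements of \<open>L\<^sup>1\<close> are represented by Lebesgue integrable functions. For integrable \<open>k\<close> and \<open>\<phi>\<close>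
  the integral defining the convolution exists at almost every point, so the value of the Bochner
  integral at the remaining points is irrelevant.\<close>

definition L1_solution ::
  "((real^'n::finite \<Rightarrow> complex) \<Rightarrow> (real^'n \<Rightarrow> complex) \<Rightarrow> real^'n \<Rightarrow> complex)
    \<Rightarrow> complex \<Rightarrow> (real^'n \<Rightarrow> complex) \<Rightarrow> (real^'n \<Rightarrow> complex) \<Rightarrow> (real^'n \<Rightarrow> complex) \<Rightarrow> bool" where
  "L1_solution conv l k p \<phi> \<longleftrightarrow>
     integrable lebesgue \<phi> \<and> (AE x in lebesgue. l * \<phi> x + conv k \<phi> x = p x)"

end

theory Submission
  imports Defs "HOL-Probability.Characteristic_Functions"
begin

text \<open>Chirps turn the statement into ordinary Fourier analysis. For a parameter \<open>\<Lambda>\<close> let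
  \<open>\<psi>(x) = exp(i \<Sum>(a\<^sub>j x\<^sub>j\<^sup>2 + d\<^sub>j x\<^sub>j))\<close>. Up to the constant \<open>A = \<Prod> csqrt(b\<^sub>j / 2\<pi>i)\<close> and a unimodular factor in \<open>\<omega>\<close>,
  the quadratic-phase transform of \<open>f\<close> at \<open>\<omega>\<close> is the Fourier transform of \<open>\<psi> f\<close> at the dilated
  frequency \<open>(b\<^sub>j \<omega>\<^sub>j)\<^sub>j\<close> (\<open>qpft_eq_fourier\<close>), and \<open>\<psi> (f \<otimes> g) = A (\<psi> f * \<psi> g)\<close> with the plain convolution
  (\<open>otimes_conv_eq_convolve\<close>). Since \<open>csqrt (\<mu>\<^sup>2 z) = \<bar>\<mu>\<bar> csqrt z\<close>, the second triple is the first one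
  for the parameter \<open>\<mu>\<^sup>2 \<Lambda>\<close>, so a single case remains (\<open>admissible_imp_chirp_triple\<close>).

  Put \<open>u = \<psi> \<phi>\<close>, \<open>\<kappa> = A \<psi> k\<close> and \<open>q = \<psi> p\<close>. The equation becomes \<open>\<lambda> u + \<kappa> * u = q\<close>, and \<open>S\<close> is the symbol
  \<open>\<lambda> + \<kappa>^\<close> at the dilated frequency. For this ordinary equation (\<open>convolution_equation\<close>), let
  \<open>H = q^ / (\<lambda> + \<kappa>^)\<close>, which is integrable by assumption, and let \<open>R\<close> be its inverse transform. If \<open>u\<close> is
  an integrable solution, then \<open>(\<lambda> + \<kappa>^) u^ = q^\<close>, so \<open>u^ = H\<close> and Fourier inversion gives \<open>u = R\<close>. If
  conversely \<open>R\<close> is integrable, inversion applied to \<open>H\<close> gives \<open>R^ = H\<close> almost everywhere; the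
  residual \<open>\<lambda> R + \<kappa> * R - q\<close> then has a transform vanishing almost everywhere, and it vanishes by
  injectivity. Because \<open>csqrt(b/2\<pi>i) csqrt(bi/2\<pi>) = \<bar>b\<bar>/2\<pi>\<close>, the amplitudes of the transform and of its
  inverse exactly absorb the Jacobian of the dilation, so that \<open>\<psi>\<close> times the inverse
  quadratic-phase transform of \<open>Qp/S\<close> is \<open>R\<close>.

  The analytic core is the inversion theorem on a Euclidean space (\<open>fourier_inversion_lborel\<close>). It
  is obtained by Gaussian summation: damping \<open>f^\<close> by \<open>exp(-\<epsilon>\<^sup>2\<bar>\<omega>\<bar>\<^sup>2/2)\<close> in the inversion integral yields the
  convolution of \<open>f\<close> with a Gaussian of width \<open>\<epsilon>\<close>, and both sides are compared as \<open>\<epsilon> \<rightarrow> 0\<close> after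
  integration over a box.\<close>

section \<open>Lebesgue integration on Euclidean spaces\<close>

text \<open>Fubini's theorem and changes of variables are available for Borel functions; a class in \<open>L\<^sup>1\<close> is
  therefore replaced by a Borel representative whenever one of them is needed.\<close>

lemma integrable_lebesgue_borel_representative:
  fixes f :: "'a::euclidean_space \<Rightarrow> complex"
  assumes "integrable lebesgue f"
  obtains g where "integrable lborel g" "AE x in lborel. f x = g x"
proof -
  have "(\<lambda>x. Re (f x)) \<in> borel_measurable lebesgue" "(\<lambda>x. Im (f x)) \<in> borel_measurable lebesgue"
    using assms by auto
  then obtain r s where r: "r \<in> borel_measurable lborel" "AE x in lborel. Re (f x) = r x"
    and s: "s \<in> borel_measurable lborel" "AE x in lborel. Im (f x) = s x"
    by (metis completion_ex_borel_measurable_real)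
  define g where "g = (\<lambda>x. complex_of_real (r x) + \<i> * complex_of_real (s x))"
  have g[measurable]: "g \<in> borel_measurable lborel"
    unfolding g_def using r(1) s(1) by measurable
  have fg: "AE x in lborel. f x = g x"
    using r(2) s(2) by eventually_elim (simp add: g_def complex_eq_iff)
  have "integrable lebesgue g"
    using fg by (intro integrable_cong_AE_imp[OF assms]) (auto intro: AE_completion measurable_completion)
  then show ?thesis
    using that fg g by (simp add: integrable_completion)
qed

lemma integrable_scaleR_iff:
  fixes f :: "'a \<Rightarrow> complex"
  assumes "c \<noteq> 0"
  shows "integrable M (\<lambda>x. c *\<^sub>R f x) \<longleftrightarrow> integrable M f"
  using integrable_scaleR_right[of "inverse c" M "\<lambda>x. c *\<^sub>R f x"] integrable_scaleR_right[of c M f] assms by auto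

lemma lborel_integral_affine:
  fixes f :: "'a::euclidean_space \<Rightarrow> complex"
  assumes "integrable lborel f" "c \<noteq> 0"
  shows "integrable lborel (\<lambda>x. f (t + c *\<^sub>R x))"
    and "(LINT x|lborel. f x) = \<bar>c\<bar> ^ DIM('a) *\<^sub>R (LINT x|lborel. f (t + c *\<^sub>R x))"
proof -
  have [measurable]: "f \<in> borel_measurable borel" using assms by auto
  have eq: "lborel = density (distr lborel borel (\<lambda>x. t + c *\<^sub>R x)) (\<lambda>_. \<bar>c\<bar>^DIM('a))"
    by (rule lborel_affine[OF assms(2)])
  have "integrable (density (distr lborel borel (\<lambda>x. t + c *\<^sub>R x)) (\<lambda>_. \<bar>c\<bar>^DIM('a))) f"
    using assms(1) eq by simp
  then show "integrable lborel (\<lambda>x. f (t + c *\<^sub>R x))"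
    using assms(2) by (subst (asm) integrable_density) (auto simp: integrable_distr_eq integrable_scaleR_iff)
  show "(LINT x|lborel. f x) = \<bar>c\<bar> ^ DIM('a) *\<^sub>R (LINT x|lborel. f (t + c *\<^sub>R x))"
    by (subst eq, subst integral_density) (auto simp: integral_distr)
qed

text \<open>The integrability behind every exchange of integrals in the inversion theorem, whose kernels are
  characters and Gaussians.\<close>

lemma integrable_bounded_kernel:
  fixes u v :: "'a::euclidean_space \<Rightarrow> complex" and m :: "'a \<Rightarrow> 'a \<Rightarrow> complex"
  assumes u: "integrable lborel u" and v: "integrable lborel v"
    and m: "case_prod m \<in> borel_measurable (lborel \<Otimes>\<^sub>M lborel)" and b: "\<And>x y. norm (m x y) \<le> C"
  shows "integrable (lborel \<Otimes>\<^sub>M lborel) (\<lambda>(x, y). m x y * u x * v y)"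
proof -
  have [measurable]: "u \<in> borel_measurable borel" "v \<in> borel_measurable borel" using u v by auto
  note m[measurable]
  have "integrable (lborel \<Otimes>\<^sub>M lborel) (\<lambda>(x, y). u x * v y)"
  proof (rule lborel_pair.Fubini_integrable)
    show "integrable lborel (\<lambda>x. LINT y|lborel. norm (case (x, y) of (x, y) \<Rightarrow> u x * v y))"
      using u by (simp add: norm_mult integrable_mult_left)
    show "AE x in lborel. integrable lborel (\<lambda>y. case (x, y) of (x, y) \<Rightarrow> u x * v y)"
      using v by simp
  qed measurable
  then have "integrable (lborel \<Otimes>\<^sub>M lborel) (\<lambda>z. of_real C * (case z of (x, y) \<Rightarrow> u x * v y))"
    by (rule integrable_mult_right)
  then show ?thesis
  proof (rule Bochner_Integration.integrable_bound)
    have "norm (m x y * u x * v y) \<le> norm (of_real C * (u x * v y))" for x y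
      using mult_right_mono[OF order.trans[OF b[of x y] abs_ge_self], of "norm (u x * v y)"]
      by (simp add: norm_mult mult.assoc)
    then show "AE z in lborel \<Otimes>\<^sub>M lborel. norm (case z of (x, y) \<Rightarrow> m x y * u x * v y)
        \<le> norm (of_real C * (case z of (x, y) \<Rightarrow> u x * v y))"
      by (auto split: prod.split)
  qed measurable
qed

text \<open>Boxes form an intersection-stable generator of the Borel sets. Cutting \<open>h\<close> off to a fixed box makes
  it integrable, and then the sets over which its integral vanishes form a Dynkin system containing
  the boxes.\<close>

lemma AE_eq_0_if_integral_box_eq_0:
  fixes h :: "'a::euclidean_space \<Rightarrow> complex"
  assumes int: "\<And>a b. set_integrable lborel (box a b) h"
    and zero: "\<And>a b. (LINT x:box a b|lborel. h x) = 0"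
  shows "AE x in lborel. h x = 0"
proof -
  have on_box: "AE x in lborel. indicator (box a b) x *\<^sub>R h x = 0" for a b
  proof (rule sigma_finite_measure.density_zero[OF sigma_finite_lborel])
    let ?h = "\<lambda>x. indicator (box a b) x *\<^sub>R h x"
    show I: "integrable lborel ?h"
      using int[of a b] by (simp add: set_integrable_def)
    have I': "set_integrable lborel A ?h" if "A \<in> sets borel" for A
      unfolding set_integrable_def using integrable_mult_indicator[OF _ I] that by simp
    fix A :: "'a set" assume "A \<in> sets lborel"
    then have A: "A \<in> sigma_sets UNIV (range (\<lambda>(a, b). box a b))"
      by (simp add: borel_eq_box)
    have stable: "Int_stable (range (\<lambda>(a, b). box a b :: 'a set))"
    proof (rule Int_stableI)
      fix P Q :: "'a set" assume "P \<in> range (\<lambda>(a, b). box a b)" "Q \<in> range (\<lambda>(a, b). box a b)"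
      then obtain a b c d where PQ: "P = box a b" "Q = box c d" by auto
      obtain s t where "box a b \<inter> box c d = box s t"
        by (meson box_Int_box)
      then have "P \<inter> Q = (case (s, t) of (a, b) \<Rightarrow> box a b)" using PQ by simp
      then show "P \<inter> Q \<in> range (\<lambda>(a, b). box a b)"
        by (rule range_eqI)
    qed
    have "range (\<lambda>(a, b). box a b) \<subseteq> Pow (UNIV :: 'a set)" by simp
    from stable this A show "(LINT x:A|lborel. ?h x) = 0"
    proof (induction rule: sigma_sets_induct_disjoint)
      case (basic A)
      then obtain c d where A: "A = box c d" by auto
      obtain s t where st: "box a b \<inter> box c d = box s t"
        by (meson box_Int_box)
      have "indicator A x *\<^sub>R ?h x = indicator (box s t) x *\<^sub>R h x" for x
        unfolding st[symmetric] A by (auto simp: indicator_def)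
      then show ?case using zero[of s t] by (simp only: set_lebesgue_integral_def)
    next
      case empty then show ?case by (simp add: set_lebesgue_integral_def)
    next
      case (compl A)
      then have A: "A \<in> sets borel" by (simp add: borel_eq_box)
      have "(LINT x:(UNIV - A)|lborel. ?h x) = (LINT x|lborel. ?h x - indicator A x *\<^sub>R ?h x)"
        unfolding set_lebesgue_integral_def by (intro Bochner_Integration.integral_cong) (auto simp: indicator_def)
      also have "\<dots> = (LINT x:box a b|lborel. h x) - (LINT x:A|lborel. ?h x)"
        using I I'[OF A] unfolding set_lebesgue_integral_def set_integrable_def
        by (intro Bochner_Integration.integral_diff)
      finally show ?case using compl zero by simp
    next
      case (union A)
      then have A: "A i \<in> sets borel" for i by (auto simp: borel_eq_box)
      have "(LINT x:(\<Union>i. A i)|lborel. ?h x) = (\<Sum>i. LINT x:A i|lborel. ?h x)"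
        using A union(1) by (intro lebesgue_integral_countable_add I') (auto simp: disjoint_family_on_def)
      then show ?case using union by simp
    qed
  qed
  have "AE x in lborel. \<forall>n::nat. indicator (box (- (real n *\<^sub>R One)) (real n *\<^sub>R One)) x *\<^sub>R h x = 0"
    unfolding AE_all_countable by (intro allI on_box)
  then show ?thesis
  proof eventually_elim
    case (elim x)
    have "x \<in> (\<Union>n::nat. box (- (real n *\<^sub>R One)) (real n *\<^sub>R One))"
      unfolding UN_box_eq_UNIV by simp
    then obtain n :: nat where "x \<in> box (- (real n *\<^sub>R One)) (real n *\<^sub>R One)"
      by (rule UN_E)
    then show ?case using elim[rule_format, of n] by simp
  qed
qed

section \<open>The Fourier transform of a Gaussian\<close>

lemma measurable_cis[measurable]: "cis \<in> borel_measurable borel"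
  by (intro borel_measurable_continuous_onI continuous_on_cis continuous_on_id)

lemma integral_cis_gaussian_real:
  fixes t :: real
  shows "integrable lborel (\<lambda>x. cis (t * x) * of_real (exp (- x\<^sup>2 / 2)))" (is ?I)
    and "(LINT x|lborel. cis (t * x) * of_real (exp (- x\<^sup>2 / 2))) = of_real (sqrt (2 * pi) * exp (- t\<^sup>2 / 2))" (is ?E)
proof -
  have std: "integrable lborel (std_normal_density)"
    using integrable_normal_density[of 1 0] by simp
  have eq: "cis (t * x) * of_real (exp (- x\<^sup>2 / 2)) = of_real (sqrt (2 * pi)) * (std_normal_density x *\<^sub>R cis (t * x))" for x
    by (simp add: std_normal_density_def scaleR_conv_of_real)
  have "integrable lborel (\<lambda>x. std_normal_density x *\<^sub>R cis (t * x))"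
    by (rule Bochner_Integration.integrable_bound[OF std]) (auto simp: cis_conv_exp norm_mult)
  then show ?I unfolding eq by (rule integrable_mult_right)
  have "(LINT x|lborel. std_normal_density x *\<^sub>R cis (t * x)) = char std_normal_distribution t"
    unfolding char_def by (subst integral_density) (auto simp: cis_conv_exp)
  then show ?E unfolding eq integral_mult_right_zero by (simp add: char_std_normal_distribution)
qed

text \<open>Both the Gaussian and the character are products over the coordinates, so the one-dimensional
  formula is applied factor by factor.\<close>

lemma integral_cis_gaussian:
  fixes \<omega> :: "'a::euclidean_space"
  shows "integrable lborel (\<lambda>x. cis (\<omega> \<bullet> x) * of_real (exp (- (norm x)\<^sup>2 / 2)))" (is ?I)
    and "(LINT x|lborel. cis (\<omega> \<bullet> x) * of_real (exp (- (norm x)\<^sup>2 / 2)))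
      = of_real (sqrt (2 * pi) ^ DIM('a) * exp (- (norm \<omega>)\<^sup>2 / 2))" (is ?E)
proof -
  interpret product_sigma_finite "\<lambda>_::'a. lborel :: real measure" ..
  let ?g = "\<lambda>b x. cis ((\<omega> \<bullet> b) * x) * complex_of_real (exp (- x\<^sup>2 / 2))"
  have prod: "cis (\<omega> \<bullet> x) * of_real (exp (- (norm x)\<^sup>2 / 2)) = (\<Prod>b\<in>Basis. ?g b (x \<bullet> b))" for x
  proof -
    have 1: "(norm x)\<^sup>2 = (\<Sum>b\<in>Basis. (x \<bullet> b)\<^sup>2)"
      unfolding power2_norm_eq_inner by (subst euclidean_inner) (simp add: power2_eq_square)
    have 2: "\<omega> \<bullet> x = (\<Sum>b\<in>Basis. (\<omega> \<bullet> b) * (x \<bullet> b))"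
      by (rule euclidean_inner)
    show ?thesis
      by (simp add: 1 2 cis_conv_exp prod.distrib exp_sum sum_distrib_left sum_divide_distrib of_real_exp[symmetric] flip: sum_negf)
  qed
  have coord: "(\<Sum>b'\<in>Basis. f b' *\<^sub>R b') \<bullet> b = f b" if "b \<in> Basis" for f and b :: 'a
    using that by (simp add: inner_sum_left inner_Basis if_distrib cong: if_cong)
  have g: "integrable lborel (?g b)" for b
    by (rule integral_cis_gaussian_real)
  have m[measurable]: "(\<lambda>x. cis (\<omega> \<bullet> x) * of_real (exp (- (norm x)\<^sup>2 / 2))) \<in> borel_measurable borel"
    unfolding cis_conv_exp by measurable
  have T[measurable]: "(\<lambda>f. \<Sum>b\<in>Basis. f b *\<^sub>R b) \<in> (\<Pi>\<^sub>M b\<in>(Basis::'a set). (lborel::real measure)) \<rightarrow>\<^sub>M borel"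
    by measurable
  have pr: "(\<Prod>b\<in>Basis. ?g b ((\<Sum>b'\<in>Basis. f b' *\<^sub>R b') \<bullet> b)) = (\<Prod>b\<in>Basis. ?g b (f b))" for f
    by (intro prod.cong refl) (simp only: coord)
  show ?I
    unfolding lborel_eq[where 'a='a]
    by (subst integrable_distr_eq[OF T m], unfold prod pr, rule product_integrable_prod[OF _ g]) simp
  have "(LINT x|lborel. cis (\<omega> \<bullet> x) * of_real (exp (- (norm x)\<^sup>2 / 2))) = (\<Prod>b\<in>(Basis::'a set). LINT x|lborel. ?g b x)"
    unfolding lborel_eq[where 'a='a]
    by (subst integral_distr[OF T m], unfold prod pr, rule product_integral_prod[OF _ g]) simp
  also have "\<dots> = of_real (sqrt (2 * pi) ^ DIM('a) * (\<Prod>b\<in>(Basis::'a set). exp (- (\<omega> \<bullet> b)\<^sup>2 / 2)))"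
    unfolding integral_cis_gaussian_real by (simp add: prod.distrib)
  also have "(\<Prod>b\<in>(Basis::'a set). exp (- (\<omega> \<bullet> b)\<^sup>2 / 2)) = exp (- (norm \<omega>)\<^sup>2 / 2)"
    unfolding power2_norm_eq_inner by (subst euclidean_inner) (simp add: power2_eq_square exp_sum sum_divide_distrib flip: sum_negf)
  finally show ?E .
qed

section \<open>Fourier inversion\<close>

text \<open>Write \<open>g\<close> for the right-hand side and \<open>A \<epsilon>\<close> for the same integral damped by the Gaussian \<open>G(\<epsilon>\<omega>)\<close>.
  Then \<open>A \<epsilon> \<rightarrow> g\<close> pointwise and boundedly, because \<open>F\<close> is integrable. On the other hand \<open>A \<epsilon>\<close> is the
  convolution of \<open>f\<close> with \<open>\<epsilon>\<^sup>-\<^sup>N \<Gamma>(\<cdot>/\<epsilon>)\<close>; its integral over a box is the integral of \<open>f\<close> against the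
  smoothed indicator of the box, and this smoothed indicator converges to the indicator off the
  frontier, a null set. So \<open>f\<close> and \<open>g\<close> have the same integral over every box. Testing against
  boxes avoids any statement on convergence of \<open>A \<epsilon>\<close> to \<open>f\<close> itself.\<close>

lemma fourier_inversion_lborel:
  fixes f :: "'a::euclidean_space \<Rightarrow> complex"
  defines "F \<equiv> \<lambda>\<omega>. LINT x|lborel. cis (\<omega> \<bullet> x) * f x"
  assumes f: "integrable lborel f" and F: "integrable lborel F"
  shows "AE x in lborel. f x = (LINT \<omega>|lborel. cis (- (\<omega> \<bullet> x)) * F \<omega>) / of_real ((2 * pi) ^ DIM('a))"
proof -
  define N where "N = DIM('a)"
  define G :: "'a \<Rightarrow> complex" where "G x = of_real (exp (- (norm x)\<^sup>2 / 2))" for x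
  define \<Gamma> :: "'a \<Rightarrow> complex" where "\<Gamma> z = G z / of_real (sqrt (2 * pi) ^ N)" for z
  define g where "g y = (LINT \<omega>|lborel. cis (- (\<omega> \<bullet> y)) * F \<omega>) / of_real ((2 * pi) ^ N)" for y
  define A where "A \<epsilon> y = (LINT \<omega>|lborel. (cis (- (\<omega> \<bullet> y)) * G (\<epsilon> *\<^sub>R \<omega>)) * F \<omega>) / of_real ((2 * pi) ^ N)" for \<epsilon> y
  define \<epsilon> where "\<epsilon> n = inverse (real (Suc n))" for n
  have [measurable]: "f \<in> borel_measurable borel" "F \<in> borel_measurable borel" using f F by auto
  have Gm[measurable]: "G \<in> borel_measurable borel" unfolding G_def by measurable
  have \<Gamma>m[measurable]: "\<Gamma> \<in> borel_measurable borel" unfolding \<Gamma>_def by measurable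
  have \<epsilon>_pos: "\<epsilon> n > 0" for n by (simp add: \<epsilon>_def)
  have \<epsilon>_lim: "\<epsilon> \<longlonglongrightarrow> 0" unfolding \<epsilon>_def by (rule LIMSEQ_inverse_real_of_nat)
  have G_le: "norm (G x) \<le> 1" for x by (simp add: G_def)
  have FG: "(LINT x|lborel. cis (\<omega> \<bullet> x) * G x) = of_real (sqrt (2 * pi) ^ N) * G \<omega>"
    and FG_int: "integrable lborel (\<lambda>x. cis (\<omega> \<bullet> x) * G x)" for \<omega>
    using integral_cis_gaussian[of \<omega>] by (auto simp: G_def N_def)
  have G_int: "integrable lborel G" and G0: "(LINT x|lborel. G x) = of_real (sqrt (2 * pi) ^ N)"
    using FG[of 0] FG_int[of 0] by (auto simp: G_def[abs_def])
  have \<Gamma>_int: "integrable lborel \<Gamma>" and \<Gamma>1: "(LINT x|lborel. \<Gamma> x) = 1"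
    using G_int G0 by (auto simp: \<Gamma>_def[abs_def])
  have \<Gamma>_le: "norm (\<Gamma> z) \<le> inverse (sqrt (2 * pi) ^ N)" for z
    using divide_right_mono[OF G_le[of z], of "sqrt (2 * pi) ^ N"] by (simp add: \<Gamma>_def norm_divide norm_power inverse_eq_divide)
  have sq: "complex_of_real (sqrt (2 * pi) ^ N) * of_real (sqrt (2 * pi) ^ N) = of_real ((2 * pi) ^ N)"
    unfolding of_real_mult[symmetric] power_mult_distrib[symmetric] by simp

  \<comment> \<open>Multiplication formula: the transform is moved from \<open>f\<close> to the damped character.\<close>
  have A_eq: "A e y = (LINT x|lborel. f x * (\<Gamma> ((x - y) /\<^sub>R e) / of_real (e ^ N)))" if e: "e > 0" for e y
  proof -
    let ?h = "\<lambda>\<omega>. cis (- (\<omega> \<bullet> y)) * G (e *\<^sub>R \<omega>)"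
    have Ge: "integrable lborel (\<lambda>\<omega>. G (e *\<^sub>R \<omega>))"
      using lborel_integral_affine(1)[OF G_int, of e 0] e by simp
    have h: "integrable lborel ?h"
      by (rule Bochner_Integration.integrable_bound[OF Ge]) (auto simp: norm_mult)
    have inner: "(LINT \<omega>|lborel. cis (x \<bullet> \<omega>) * ?h \<omega>) = of_real ((2 * pi) ^ N) * (\<Gamma> ((x - y) /\<^sub>R e) / of_real (e ^ N))" for x
    proof -
      have "(LINT \<omega>|lborel. cis (x \<bullet> \<omega>) * ?h \<omega>) = (LINT \<omega>|lborel. cis (((x - y) /\<^sub>R e) \<bullet> (0 + e *\<^sub>R \<omega>)) * G (0 + e *\<^sub>R \<omega>))"
        using e by (intro Bochner_Integration.integral_cong) (simp_all add: cis_mult inner_diff_left inner_diff_right inner_commute mult.assoc[symmetric])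
      also have "of_real (e ^ N) * \<dots> = (LINT \<omega>|lborel. cis (((x - y) /\<^sub>R e) \<bullet> \<omega>) * G \<omega>)"
        using lborel_integral_affine(2)[OF FG_int[of "(x - y) /\<^sub>R e"], of e 0] e by (simp add: N_def scaleR_conv_of_real)
      also have "\<dots> = of_real ((2 * pi) ^ N) * \<Gamma> ((x - y) /\<^sub>R e)"
        unfolding FG \<Gamma>_def sq[symmetric] by simp
      finally show ?thesis using e by (simp add: field_simps)
    qed
    have I: "integrable (lborel \<Otimes>\<^sub>M lborel) (\<lambda>(x, \<omega>). cis (x \<bullet> \<omega>) * f x * ?h \<omega>)"
      by (rule integrable_bounded_kernel[OF f h, of _ 1]) (simp_all, measurable)
    have "(LINT \<omega>|lborel. ?h \<omega> * F \<omega>) = (LINT \<omega>|lborel. (LINT x|lborel. cis (x \<bullet> \<omega>) * f x * ?h \<omega>))"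
      unfolding F_def by (subst inner_commute) (simp add: mult.commute)
    also have "\<dots> = (LINT x|lborel. (LINT \<omega>|lborel. cis (x \<bullet> \<omega>) * f x * ?h \<omega>))"
      by (rule lborel_pair.Fubini_integral[OF I])
    also have "\<dots> = (LINT x|lborel. f x * (LINT \<omega>|lborel. cis (x \<bullet> \<omega>) * ?h \<omega>))"
      by (simp add: mult_ac flip: integral_mult_right_zero)
    also have "\<dots> = of_real ((2 * pi) ^ N) * (LINT x|lborel. f x * (\<Gamma> ((x - y) /\<^sub>R e) / of_real (e ^ N)))"
      unfolding inner by (simp add: mult.left_commute flip: integral_mult_right_zero)
    finally show ?thesis by (simp add: A_def)
  qed

  define M where "M = (LINT \<omega>|lborel. norm (F \<omega>)) / (2 * pi) ^ N"
  have A_le: "norm (A e y) \<le> M" for e y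
  proof -
    have "norm (LINT \<omega>|lborel. (cis (- (\<omega> \<bullet> y)) * G (e *\<^sub>R \<omega>)) * F \<omega>) \<le> (LINT \<omega>|lborel. norm (F \<omega>))"
    proof (rule Bochner_Integration.integral_norm_bound_integral)
      show "integrable lborel (\<lambda>\<omega>. (cis (- (\<omega> \<bullet> y)) * G (e *\<^sub>R \<omega>)) * F \<omega>)"
        by (rule Bochner_Integration.integrable_bound[OF F])
          (auto simp: norm_mult intro!: mult_left_le_one_le G_le)
    qed (use F in \<open>auto simp: norm_mult intro!: mult_left_le_one_le G_le\<close>)
    then show ?thesis
      unfolding A_def M_def norm_divide by (intro divide_mono) (simp_all add: norm_power norm_mult)
  qed

  \<comment> \<open>Removing the damping, by dominated convergence with the bound \<open>|F|\<close>.\<close>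
  have A_lim: "(\<lambda>n. A (\<epsilon> n) y) \<longlonglongrightarrow> g y" for y
  proof -
    have "(\<lambda>n. LINT \<omega>|lborel. (cis (- (\<omega> \<bullet> y)) * G (\<epsilon> n *\<^sub>R \<omega>)) * F \<omega>) \<longlonglongrightarrow> (LINT \<omega>|lborel. cis (- (\<omega> \<bullet> y)) * F \<omega>)"
    proof (rule integral_dominated_convergence[where w="\<lambda>\<omega>. norm (F \<omega>)"])
      have "(\<lambda>n. G (\<epsilon> n *\<^sub>R \<omega>)) \<longlonglongrightarrow> G (0 *\<^sub>R \<omega>)" for \<omega>
        unfolding G_def by (intro tendsto_intros \<epsilon>_lim) simp
      then have "(\<lambda>n. cis (- (\<omega> \<bullet> y)) * G (\<epsilon> n *\<^sub>R \<omega>) * F \<omega>) \<longlonglongrightarrow> cis (- (\<omega> \<bullet> y)) * G (0 *\<^sub>R \<omega>) * F \<omega>" for \<omega>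
        by (intro tendsto_intros) auto
      then show "AE \<omega> in lborel. (\<lambda>n. cis (- (\<omega> \<bullet> y)) * G (\<epsilon> n *\<^sub>R \<omega>) * F \<omega>) \<longlonglongrightarrow> cis (- (\<omega> \<bullet> y)) * F \<omega>"
        by (simp add: G_def)
    qed (use F in \<open>auto simp: norm_mult intro!: mult_left_le_one_le G_le\<close>)
    then show ?thesis unfolding A_def g_def by (intro tendsto_divide) auto
  qed

  have g_m[measurable]: "g \<in> borel_measurable borel"
    unfolding g_def by measurable
  have g_le: "norm (g y) \<le> M" for y
    by (rule Lim_bounded[OF tendsto_norm[OF A_lim], of 0]) (intro allI impI A_le)

  have box_int: "set_integrable lborel (box a b) g" for a b
    unfolding set_integrable_def
    by (rule integrableI_bounded_set_indicator[where B=M])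
      (use g_le emeasure_lborel_box_finite in auto)
  have f_box_int: "set_integrable lborel (box a b) f" for a b
    unfolding set_integrable_def by (rule integrable_mult_indicator[OF _ f]) simp

  have box_eq: "(LINT x:box a b|lborel. f x) = (LINT x:box a b|lborel. g x)" for a b
  proof -
    \<comment> \<open>The indicator of the box is complex-valued so that it fits the complex kernels; \<open>W n\<close> is its smoothing at scale \<open>\<epsilon> n\<close>.\<close>
    define \<iota> :: "'a \<Rightarrow> complex" where "\<iota> = (\<lambda>x. of_real (indicator (box a b) x))"
    have \<iota>_le: "norm (\<iota> x) \<le> 1" for x by (simp add: \<iota>_def indicator_def)
    have \<iota>m[measurable]: "\<iota> \<in> borel_measurable borel" unfolding \<iota>_def by simp
    have \<iota>_int: "integrable lborel \<iota>"
      unfolding \<iota>_def by (intro integrable_of_real integrable_real_indicator emeasure_lborel_box_finite) simp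
    define W where "W n x = (LINT z|lborel. \<iota> (x - \<epsilon> n *\<^sub>R z) * \<Gamma> z)" for n x
    have W_int: "integrable lborel (\<lambda>z. \<iota> (x - \<epsilon> n *\<^sub>R z) * \<Gamma> z)" for x n
      by (rule Bochner_Integration.integrable_bound[OF \<Gamma>_int]) (auto simp: norm_mult intro!: mult_left_le_one_le \<iota>_le)
    have W_le: "norm (W n x) \<le> (LINT z|lborel. norm (\<Gamma> z))" for n x
      unfolding W_def by (rule Bochner_Integration.integral_norm_bound_integral[OF W_int])
       (use \<Gamma>_int in \<open>auto simp: norm_mult intro!: mult_left_le_one_le \<iota>_le\<close>)
    have W_lim: "(\<lambda>n. W n x) \<longlonglongrightarrow> \<iota> x" if x: "x \<notin> frontier (box a b)" for x
    proof -
      have "(\<lambda>n. W n x) \<longlonglongrightarrow> (LINT z|lborel. \<iota> x * \<Gamma> z)"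
        unfolding W_def
      proof (rule integral_dominated_convergence[where w="\<lambda>z. norm (\<Gamma> z)"])
        have "(\<lambda>n. \<iota> (x - \<epsilon> n *\<^sub>R z)) \<longlonglongrightarrow> \<iota> x" for z
        proof -
          have lim: "(\<lambda>n. x - \<epsilon> n *\<^sub>R z) \<longlonglongrightarrow> x"
            using tendsto_diff[OF tendsto_const tendsto_scaleR[OF \<epsilon>_lim tendsto_const], of x z] by simp
          have "isCont \<iota> x"
            unfolding \<iota>_def using x by (intro continuous_of_real) (simp add: isCont_indicator)
          then show ?thesis using lim by (rule isCont_tendsto_compose)
        qed
        then show "AE z in lborel. (\<lambda>n. \<iota> (x - \<epsilon> n *\<^sub>R z) * \<Gamma> z) \<longlonglongrightarrow> \<iota> x * \<Gamma> z"
          by (intro AE_I2 tendsto_mult) auto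
      qed (use \<Gamma>_int in \<open>auto simp: norm_mult intro!: mult_left_le_one_le \<iota>_le\<close>)
      then show ?thesis by (simp add: \<Gamma>1)
    qed
    have swap: "(LINT y|lborel. \<iota> y * A (\<epsilon> n) y) = (LINT x|lborel. f x * W n x)" for n
    proof -
      let ?k = "\<lambda>x y. \<Gamma> ((x - y) /\<^sub>R \<epsilon> n) / of_real (\<epsilon> n ^ N)"
      have I: "integrable (lborel \<Otimes>\<^sub>M lborel) (\<lambda>(x, y). ?k x y * f x * \<iota> y)"
        by (rule integrable_bounded_kernel[OF f \<iota>_int, of _ "inverse (sqrt (2 * pi) ^ N) / \<epsilon> n ^ N"])
          (use \<epsilon>_pos[of n] \<Gamma>_le in \<open>auto simp: norm_divide norm_power intro!: divide_right_mono\<close>)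
      have inner: "(LINT y|lborel. ?k x y * \<iota> y) = W n x" for x
      proof -
        have "integrable (lborel) (\<lambda>y. ?k x y * \<iota> y)"
          by (rule Bochner_Integration.integrable_bound[OF integrable_mult_right[OF \<iota>_int, of "of_real (inverse (sqrt (2 * pi) ^ N) / \<epsilon> n ^ N)"]])
           (use \<epsilon>_pos[of n] \<Gamma>_le in \<open>auto simp: norm_divide norm_mult norm_power norm_inverse simp del: of_real_divide intro!: mult_right_mono divide_right_mono\<close>)
        \<comment> \<open>The substitution \<open>y = x - \<epsilon> z\<close> cancels the normalising power of \<open>\<epsilon>\<close>.\<close>
        from lborel_integral_affine(2)[OF this, of "- \<epsilon> n" x] \<epsilon>_pos[of n]
        have "(LINT y|lborel. ?k x y * \<iota> y) = \<epsilon> n ^ N *\<^sub>R (LINT z|lborel. \<Gamma> z / of_real (\<epsilon> n ^ N) * \<iota> (x - \<epsilon> n *\<^sub>R z))"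
          by (simp add: N_def)
        also have "\<dots> = (LINT z|lborel. of_real (\<epsilon> n ^ N) * (\<Gamma> z / of_real (\<epsilon> n ^ N) * \<iota> (x - \<epsilon> n *\<^sub>R z)))"
          unfolding scaleR_conv_of_real by (rule integral_mult_right_zero[symmetric])
        also have "\<dots> = W n x"
          unfolding W_def using \<epsilon>_pos[of n] by (intro Bochner_Integration.integral_cong) auto
        finally show ?thesis .
      qed
      have "(LINT y|lborel. \<iota> y * A (\<epsilon> n) y) = (LINT y|lborel. (LINT x|lborel. ?k x y * f x * \<iota> y))"
        unfolding A_eq[OF \<epsilon>_pos] by (simp add: mult_ac flip: integral_mult_right_zero)
      also have "\<dots> = (LINT x|lborel. (LINT y|lborel. ?k x y * f x * \<iota> y))"
        by (rule lborel_pair.Fubini_integral[OF I])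
      also have "\<dots> = (LINT x|lborel. f x * (LINT y|lborel. ?k x y * \<iota> y))"
        by (simp add: mult_ac flip: integral_mult_right_zero)
      finally show ?thesis unfolding inner .
    qed
    have W_m[measurable]: "W n \<in> borel_measurable borel" for n
      unfolding W_def by measurable
    have A_m[measurable]: "A e \<in> borel_measurable borel" for e
      unfolding A_def by measurable
    have lim1: "(\<lambda>n. LINT x|lborel. f x * W n x) \<longlonglongrightarrow> (LINT x|lborel. f x * \<iota> x)"
    proof (rule integral_dominated_convergence[where w="\<lambda>x. norm (f x) * (LINT z|lborel. norm (\<Gamma> z))"])
      have "frontier (box a b) \<in> null_sets lebesgue"
        using negligible_convex_frontier[OF convex_box(2)] by (simp add: negligible_iff_null_sets)
      then have "frontier (box a b) \<in> null_sets lborel"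
        by (simp add: null_sets_completion_iff)
      then have "AE x in lborel. x \<notin> frontier (box a b)"
        by (rule AE_not_in)
      then show "AE x in lborel. (\<lambda>n. f x * W n x) \<longlonglongrightarrow> f x * \<iota> x"
        by eventually_elim (intro tendsto_mult tendsto_const W_lim)
    qed (use f W_le in \<open>auto simp: norm_mult intro!: mult_left_mono\<close>)
    have lim2: "(\<lambda>n. LINT y|lborel. \<iota> y * A (\<epsilon> n) y) \<longlonglongrightarrow> (LINT y|lborel. \<iota> y * g y)"
    proof (rule integral_dominated_convergence[where w="\<lambda>y. norm (\<iota> y) * M"])
      show "AE y in lborel. (\<lambda>n. \<iota> y * A (\<epsilon> n) y) \<longlonglongrightarrow> \<iota> y * g y"
        by (intro AE_I2 tendsto_mult tendsto_const A_lim)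
    qed (use \<iota>_int A_le in \<open>auto simp: norm_mult intro!: mult_left_mono\<close>)
    have "(LINT x|lborel. f x * \<iota> x) = (LINT y|lborel. \<iota> y * g y)"
      using LIMSEQ_unique[OF lim1] lim2 by (simp add: swap)
    moreover have "indicator (box a b) x *\<^sub>R c = c * \<iota> x" for x and c :: complex
      by (simp add: \<iota>_def indicator_def)
    ultimately show ?thesis unfolding set_lebesgue_integral_def by (simp add: mult.commute)
  qed
  have "AE x in lborel. f x - g x = 0"
  proof (rule AE_eq_0_if_integral_box_eq_0)
    show "set_integrable lborel (box a b) (\<lambda>x. f x - g x)" for a b
      by (rule set_integral_diff(1)[OF f_box_int box_int])
    show "(LINT x:box a b|lborel. f x - g x) = 0" for a b
      using set_integral_diff(2)[OF f_box_int box_int, of a b] box_eq by simp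
  qed
  then show ?thesis unfolding g_def N_def by simp
qed

text \<open>The sign of the exponent and the missing normalisation are those of the quadratic-phase kernel
  once its amplitude is split off. Lebesgue measure, rather than its Borel restriction, makes the
  integral depend only on the class of \<open>f\<close> modulo null sets.\<close>

definition fourier :: "('a::euclidean_space \<Rightarrow> complex) \<Rightarrow> 'a \<Rightarrow> complex" where
  "fourier f \<omega> = (LINT x|lebesgue. cis (\<omega> \<bullet> x) * f x)"

text \<open>From here on functions are only Lebesgue measurable; this transports measurability from a Borel
  representative.\<close>

lemma AE_eq_imp_measurable_lebesgue:
  fixes f g :: "'a::euclidean_space \<Rightarrow> complex"
  assumes "g \<in> borel_measurable borel" "AE x in lborel. f x = g x"
  shows "f \<in> borel_measurable lebesgue"
proof (rule borel_measurable_AE)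
  show "g \<in> borel_measurable lebesgue" using assms(1) by (intro measurable_completion) simp
  show "AE x in lebesgue. g x = f x" by (rule AE_completion) (use assms(2) in eventually_elim, simp)
qed

lemma integrable_lebesgue_unimodular_mult:
  fixes c f :: "'a::euclidean_space \<Rightarrow> complex"
  assumes "integrable lebesgue f" "c \<in> borel_measurable borel" "\<And>x. norm (c x) \<le> 1"
  shows "integrable lebesgue (\<lambda>x. c x * f x)"
proof (rule Bochner_Integration.integrable_bound[OF assms(1)])
  have "c \<in> borel_measurable lebesgue" using assms(2) by (intro measurable_completion) simp
  then show "(\<lambda>x. c x * f x) \<in> borel_measurable lebesgue" using assms(1) by measurable
  show "AE x in lebesgue. norm (c x * f x) \<le> norm (f x)"
    using assms(3) by (auto simp: norm_mult intro!: mult_left_le_one_le)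
qed

lemma fourier_lborel:
  assumes [measurable]: "f \<in> borel_measurable borel"
  shows "fourier f \<omega> = (LINT x|lborel. cis (\<omega> \<bullet> x) * f x)"
  unfolding fourier_def by (rule integral_completion) measurable

lemma fourier_cong_AE:
  assumes "f \<in> borel_measurable lebesgue" "g \<in> borel_measurable lebesgue" "AE x in lebesgue. f x = g x"
  shows "fourier f \<omega> = fourier g \<omega>"
  unfolding fourier_def
proof (rule integral_cong_AE)
  have [measurable]: "(\<lambda>x. cis (\<omega> \<bullet> x)) \<in> borel_measurable lebesgue"
    by (intro measurable_completion) measurable
  show "(\<lambda>x. cis (\<omega> \<bullet> x) * f x) \<in> borel_measurable lebesgue" "(\<lambda>x. cis (\<omega> \<bullet> x) * g x) \<in> borel_measurable lebesgue"
    using assms(1,2) by measurable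
  show "AE x in lebesgue. cis (\<omega> \<bullet> x) * f x = cis (\<omega> \<bullet> x) * g x"
    using assms(3) by eventually_elim simp
qed

lemma fourier_eq_lborel:
  assumes "integrable lborel g" "AE x in lborel. f x = g x"
  shows "fourier f \<omega> = (LINT x|lborel. cis (\<omega> \<bullet> x) * g x)"
proof -
  have g: "g \<in> borel_measurable borel" using assms(1) by auto
  have "fourier f \<omega> = fourier g \<omega>"
  proof (rule fourier_cong_AE)
    show "f \<in> borel_measurable lebesgue" by (rule AE_eq_imp_measurable_lebesgue[OF g assms(2)])
    show "g \<in> borel_measurable lebesgue" using g by (intro measurable_completion) simp
    show "AE x in lebesgue. f x = g x" by (rule AE_completion[OF assms(2)])
  qed
  then show ?thesis by (simp add: fourier_lborel[OF g])
qed

lemma measurable_fourier: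
  assumes "integrable lebesgue f"
  shows "fourier f \<in> borel_measurable borel"
proof -
  obtain g where g: "integrable lborel g" "AE x in lborel. f x = g x"
    using integrable_lebesgue_borel_representative[OF assms] .
  have [measurable]: "g \<in> borel_measurable borel" using g by auto
  have "(\<lambda>\<omega>. LINT x|lborel. cis (\<omega> \<bullet> x) * g x) \<in> borel_measurable borel" by measurable
  moreover have "fourier f = (\<lambda>\<omega>. LINT x|lborel. cis (\<omega> \<bullet> x) * g x)"
    by (intro ext fourier_eq_lborel[OF g])
  ultimately show ?thesis by simp
qed

lemma integrable_fourier_integrand:
  assumes "integrable lebesgue f"
  shows "integrable lebesgue (\<lambda>x. cis (\<omega> \<bullet> x) * f x)"
  by (rule integrable_lebesgue_unimodular_mult[OF assms]) simp_all

lemma fourier_linear: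
  assumes "integrable lebesgue f" "integrable lebesgue g"
  shows "fourier (\<lambda>x. c * f x + g x) \<omega> = c * fourier f \<omega> + fourier g \<omega>"
proof -
  note I = integrable_fourier_integrand[OF assms(1), of \<omega>] integrable_fourier_integrand[OF assms(2), of \<omega>]
  have "fourier (\<lambda>x. c * f x + g x) \<omega> = (LINT x|lebesgue. c * (cis (\<omega> \<bullet> x) * f x) + cis (\<omega> \<bullet> x) * g x)"
    unfolding fourier_def by (intro Bochner_Integration.integral_cong) (auto simp: algebra_simps)
  then show ?thesis
    using Bochner_Integration.integral_add[OF integrable_mult_right[OF I(1), of c] I(2)] by (simp add: fourier_def)
qed

lemma fourier_inversion:
  fixes f :: "'a::euclidean_space \<Rightarrow> complex"
  assumes "integrable lebesgue f" "integrable lebesgue (fourier f)"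
  shows "AE x in lebesgue. f x = fourier (fourier f) (- x) / of_real ((2 * pi) ^ DIM('a))"
proof -
  obtain g where g: "integrable lborel g" "AE x in lborel. f x = g x"
    using integrable_lebesgue_borel_representative[OF assms(1)] .
  have [measurable]: "g \<in> borel_measurable borel" using g by auto
  have eq: "fourier f = (\<lambda>\<omega>. LINT x|lborel. cis (\<omega> \<bullet> x) * g x)"
    by (intro ext fourier_eq_lborel g)
  have m: "fourier f \<in> borel_measurable borel" by (rule measurable_fourier[OF assms(1)])
  have "AE x in lborel. g x = (LINT \<omega>|lborel. cis (- (\<omega> \<bullet> x)) * fourier f \<omega>) / of_real ((2 * pi) ^ DIM('a))"
    using assms(2) m unfolding eq by (intro fourier_inversion_lborel[OF g(1)]) (simp add: integrable_completion)
  then have "AE x in lborel. f x = fourier (fourier f) (- x) / of_real ((2 * pi) ^ DIM('a))"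
    using g(2) unfolding fourier_lborel[OF m] by eventually_elim (simp add: inner_commute)
  then show ?thesis by (rule AE_completion)
qed

text \<open>A transform that vanishes almost everywhere is integrable, so the inversion theorem applies to it.\<close>

corollary fourier_injective:
  assumes "integrable lebesgue f" "AE \<omega> in lebesgue. fourier f \<omega> = 0"
  shows "AE x in lebesgue. f x = 0"
proof -
  have m: "fourier f \<in> borel_measurable lebesgue"
    using measurable_fourier[OF assms(1)] by (intro measurable_completion) simp
  have int: "integrable lebesgue (fourier f)"
  proof (rule integrable_cong_AE_imp)
    show "AE \<omega> in lebesgue. 0 = fourier f \<omega>" using assms(2) by eventually_elim simp
  qed (use m in simp_all)
  have "fourier (fourier f) x = fourier (\<lambda>_. 0) x" for x
    using m assms(2) by (intro fourier_cong_AE) simp_all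
  then have "fourier (fourier f) x = 0" for x by (simp add: fourier_def)
  then show ?thesis using fourier_inversion[OF assms(1) int] by simp
qed

section \<open>Convolution equations\<close>

definition convolve :: "('a::euclidean_space \<Rightarrow> complex) \<Rightarrow> ('a \<Rightarrow> complex) \<Rightarrow> 'a \<Rightarrow> complex" where
  "convolve u v x = (LINT \<tau>|lebesgue. u \<tau> * v (x - \<tau>))"

lemma lborel_integral_reflect:
  fixes f :: "'a::euclidean_space \<Rightarrow> complex"
  assumes "integrable lborel f"
  shows "integrable lborel (\<lambda>x. f (- x))" "(LINT x|lborel. f (- x)) = (LINT x|lborel. f x)"
  using lborel_integral_affine[OF assms, of "-1" 0] by simp_all

text \<open>Makes the convolution at every point independent of the representative of the second factor.\<close>

lemma AE_lborel_reflect: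
  fixes x :: "'a::euclidean_space"
  assumes "AE y in lborel. P y"
  shows "AE y in lborel. P (x - y)"
proof -
  obtain N where N: "{y \<in> space lborel. \<not> P y} \<subseteq> N" "N \<in> null_sets lborel"
    using AE_E[OF assms] by (auto simp: null_sets_def)
  have [measurable]: "N \<in> sets borel" using N by auto
  have eq: "lborel = distr lborel borel (\<lambda>y. x - y)"
    using lborel_affine[of "-1" x] by (simp add: density_1)
  have "AE y in distr lborel borel (\<lambda>y. x - y). y \<notin> N"
    unfolding eq[symmetric] using N by (intro AE_not_in)
  then have "AE y in lborel. x - y \<notin> N"
    by (subst (asm) AE_distr_iff) auto
  then show ?thesis by eventually_elim (use N in auto)
qed

lemma convolve_lborel:
  fixes u v u' v' :: "'a::euclidean_space \<Rightarrow> complex"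
  assumes "u' \<in> borel_measurable borel" "AE x in lborel. u x = u' x"
    and "v' \<in> borel_measurable borel" "AE x in lborel. v x = v' x"
  shows "convolve u v x = (LINT \<tau>|lborel. u' \<tau> * v' (x - \<tau>))"
proof -
  note [measurable] = assms(1,3)
  have "AE \<tau> in lborel. v (x - \<tau>) = v' (x - \<tau>)"
    by (rule AE_lborel_reflect[OF assms(4)])
  with assms(2) have AE: "AE \<tau> in lborel. u \<tau> * v (x - \<tau>) = u' \<tau> * v' (x - \<tau>)"
    by eventually_elim simp
  have m: "(\<lambda>\<tau>. u' \<tau> * v' (x - \<tau>)) \<in> borel_measurable lborel" by measurable
  have "convolve u v x = (LINT \<tau>|lebesgue. u' \<tau> * v' (x - \<tau>))"
    unfolding convolve_def
  proof (rule integral_cong_AE)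
    show "(\<lambda>\<tau>. u \<tau> * v (x - \<tau>)) \<in> borel_measurable lebesgue"
      using m by (intro AE_eq_imp_measurable_lebesgue[OF _ AE]) simp
    show "(\<lambda>\<tau>. u' \<tau> * v' (x - \<tau>)) \<in> borel_measurable lebesgue"
      by (rule measurable_completion[OF m])
  qed (rule AE_completion[OF AE])
  also have "\<dots> = (LINT \<tau>|lborel. u' \<tau> * v' (x - \<tau>))"
    by (rule integral_completion[OF m])
  finally show ?thesis .
qed

lemma convolve_integrable_fourier:
  fixes u v :: "'a::euclidean_space \<Rightarrow> complex"
  assumes "integrable lebesgue u" "integrable lebesgue v"
  shows integrable_convolve: "integrable lebesgue (convolve u v)"
    and fourier_convolve: "fourier (convolve u v) \<omega> = fourier u \<omega> * fourier v \<omega>"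
proof -
  obtain u' where u: "integrable lborel u'" "AE x in lborel. u x = u' x"
    using integrable_lebesgue_borel_representative[OF assms(1)] .
  obtain v' where v: "integrable lborel v'" "AE x in lborel. v x = v' x"
    using integrable_lebesgue_borel_representative[OF assms(2)] .
  have [measurable]: "u' \<in> borel_measurable borel" "v' \<in> borel_measurable borel" using u v by auto
  have conv: "convolve u v = (\<lambda>x. LINT \<tau>|lborel. u' \<tau> * v' (x - \<tau>))"
    using u v by (intro ext convolve_lborel) auto
  have v_shift: "integrable lborel (\<lambda>x. v' (x - \<tau>))"
    and norm_shift: "(LINT x|lborel. norm (v' (x - \<tau>))) = (LINT x|lborel. norm (v' x))" for \<tau>
  proof -
    show "integrable lborel (\<lambda>x. v' (x - \<tau>))"
      using lborel_integral_affine(1)[OF v(1), of 1 "- \<tau>"] by simp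
    have "integrable lborel (\<lambda>x. complex_of_real (norm (v' x)))" using v(1) by auto
    from lborel_integral_affine(2)[OF this, of 1 "- \<tau>"]
    show "(LINT x|lborel. norm (v' (x - \<tau>))) = (LINT x|lborel. norm (v' x))"
      by simp
  qed
  \<comment> \<open>Integrating over \<open>x\<close> first decouples the two factors, by translation invariance.\<close>
  have prod_int: "integrable (lborel \<Otimes>\<^sub>M lborel) (\<lambda>(\<tau>, x). u' \<tau> * v' (x - \<tau>))"
  proof (rule lborel_pair.Fubini_integrable)
    show "integrable lborel (\<lambda>\<tau>. LINT x|lborel. norm (case (\<tau>, x) of (\<tau>, x) \<Rightarrow> u' \<tau> * v' (x - \<tau>)))"
      using u(1) by (simp add: norm_mult norm_shift)
    show "AE \<tau> in lborel. integrable lborel (\<lambda>x. case (\<tau>, x) of (\<tau>, x) \<Rightarrow> u' \<tau> * v' (x - \<tau>))"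
      using v_shift by simp
  qed measurable
  have conv_int: "integrable lborel (convolve u v)"
    unfolding conv by (rule lborel_pair.integrable_snd[OF prod_int])
  then have conv_m[measurable]: "convolve u v \<in> borel_measurable borel" by auto
  show "integrable lebesgue (convolve u v)"
    using conv_int by (simp add: integrable_completion)
  have I: "integrable (lborel \<Otimes>\<^sub>M lborel) (\<lambda>(\<tau>, x). cis (\<omega> \<bullet> x) * (u' \<tau> * v' (x - \<tau>)))"
  proof (rule Bochner_Integration.integrable_bound[OF prod_int])
    show "AE z in lborel \<Otimes>\<^sub>M lborel. norm (case z of (\<tau>, x) \<Rightarrow> cis (\<omega> \<bullet> x) * (u' \<tau> * v' (x - \<tau>)))
        \<le> norm (case z of (\<tau>, x) \<Rightarrow> u' \<tau> * v' (x - \<tau>))"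
      by (auto simp: norm_mult)
  qed measurable
  have "fourier (convolve u v) \<omega> = (LINT x|lborel. cis (\<omega> \<bullet> x) * (LINT \<tau>|lborel. u' \<tau> * v' (x - \<tau>)))"
    by (simp add: fourier_lborel[OF conv_m]) (simp add: conv)
  also have "\<dots> = (LINT x|lborel. (LINT \<tau>|lborel. cis (\<omega> \<bullet> x) * (u' \<tau> * v' (x - \<tau>))))"
    by (simp only: integral_mult_right_zero)
  also have "\<dots> = (LINT \<tau>|lborel. (LINT x|lborel. cis (\<omega> \<bullet> x) * (u' \<tau> * v' (x - \<tau>))))"
    by (rule lborel_pair.Fubini_integral[OF I])
  also have "\<dots> = (LINT \<tau>|lborel. cis (\<omega> \<bullet> \<tau>) * u' \<tau> * fourier v \<omega>)"
  proof (rule Bochner_Integration.integral_cong[OF refl])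
    fix \<tau> :: 'a
    have J: "integrable lborel (\<lambda>x. cis (\<omega> \<bullet> x) * (u' \<tau> * v' (x - \<tau>)))"
      by (rule Bochner_Integration.integrable_bound[OF integrable_mult_right[OF v_shift[of \<tau>], of "u' \<tau>"]])
        (auto simp: norm_mult)
    have "(LINT x|lborel. cis (\<omega> \<bullet> x) * (u' \<tau> * v' (x - \<tau>)))
        = (LINT x|lborel. cis (\<omega> \<bullet> \<tau>) * u' \<tau> * (cis (\<omega> \<bullet> x) * v' x))"
      using lborel_integral_affine(2)[OF J, of 1 \<tau>] by (simp add: inner_add_right mult_ac flip: cis_mult)
    then show "(LINT x|lborel. cis (\<omega> \<bullet> x) * (u' \<tau> * v' (x - \<tau>))) = cis (\<omega> \<bullet> \<tau>) * u' \<tau> * fourier v \<omega>"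
      by (simp add: fourier_eq_lborel[OF v])
  qed
  also have "\<dots> = fourier u \<omega> * fourier v \<omega>"
    by (simp add: fourier_eq_lborel[OF u])
  finally show "fourier (convolve u v) \<omega> = fourier u \<omega> * fourier v \<omega>" .
qed

text \<open>Uniqueness is inversion applied to a solution; existence is inversion applied to \<open>H\<close>, followed by
  injectivity of the transform on the residual.\<close>

theorem convolution_equation:
  fixes \<kappa> q :: "'a::euclidean_space \<Rightarrow> complex" and l :: complex
  defines "H \<equiv> \<lambda>\<omega>. fourier q \<omega> / (l + fourier \<kappa> \<omega>)"
  defines "R \<equiv> \<lambda>x. fourier H (- x) / of_real ((2 * pi) ^ DIM('a))"
  assumes \<kappa>: "integrable lebesgue \<kappa>" and q: "integrable lebesgue q"
    and nz: "\<And>\<omega>. l + fourier \<kappa> \<omega> \<noteq> 0" and H: "integrable lebesgue H"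
  shows convolution_equation_unique:
      "integrable lebesgue u \<Longrightarrow> AE x in lebesgue. l * u x + convolve \<kappa> u x = q x
        \<Longrightarrow> AE x in lebesgue. u x = R x"
    and convolution_equation_solution:
      "integrable lebesgue R \<Longrightarrow> AE x in lebesgue. l * R x + convolve \<kappa> R x = q x"
proof -
  assume u: "integrable lebesgue u" and eq: "AE x in lebesgue. l * u x + convolve \<kappa> u x = q x"
  have C: "integrable lebesgue (convolve \<kappa> u)" by (rule integrable_convolve[OF \<kappa> u])
  have "(l + fourier \<kappa> \<omega>) * fourier u \<omega> = fourier q \<omega>" for \<omega>
  proof -
    have "fourier q \<omega> = fourier (\<lambda>x. l * u x + convolve \<kappa> u x) \<omega>"
    proof (rule fourier_cong_AE)
      show "AE x in lebesgue. q x = l * u x + convolve \<kappa> u x"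
        using eq by eventually_elim simp
    qed (use q u C in auto)
    also have "\<dots> = (l + fourier \<kappa> \<omega>) * fourier u \<omega>"
      by (simp add: fourier_linear[OF u C] fourier_convolve[OF \<kappa> u] distrib_right)
    finally show ?thesis by simp
  qed
  then have "fourier u = H"
    using nz by (auto simp: H_def field_simps)
  then show "AE x in lebesgue. u x = R x"
    using fourier_inversion[OF u] H unfolding R_def by simp
next
  assume R: "integrable lebesgue R"
  let ?c = "complex_of_real ((2 * pi) ^ DIM('a))"
  have c: "?c \<noteq> 0" by simp
  have Hm: "H \<in> borel_measurable borel"
    using measurable_fourier[OF \<kappa>] measurable_fourier[OF q] unfolding H_def by measurable
  have FHm[measurable]: "fourier H \<in> borel_measurable borel"
    by (rule measurable_fourier[OF H])
  have Rm: "R \<in> borel_measurable borel" unfolding R_def by measurable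
  have R': "integrable lborel R" using R Rm by (simp add: integrable_completion)
  \<comment> \<open>\<open>fourier H\<close> is \<open>R\<close> reflected and rescaled, hence integrable, which is what inversion for \<open>H\<close> needs.\<close>
  have "integrable lborel (\<lambda>x. ?c * R (- x))"
    using lborel_integral_reflect(1)[OF R'] by (rule integrable_mult_right)
  then have FH: "integrable lborel (fourier H)" using c by (simp add: R_def)
  then have inv: "AE \<omega> in lebesgue. H \<omega> = fourier (fourier H) (- \<omega>) / ?c"
    by (intro fourier_inversion[OF H]) (simp add: integrable_completion)
  \<comment> \<open>Transforming the inverse transform of \<open>H\<close> is the inversion integral of \<open>H\<close>, up to the reflection \<open>x \<mapsto> -x\<close>.\<close>
  have FR: "fourier R \<omega> = fourier (fourier H) (- \<omega>) / ?c" for \<omega>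
  proof -
    have J: "integrable lborel (\<lambda>x. cis (- \<omega> \<bullet> x) * fourier H x / ?c)"
      by (rule Bochner_Integration.integrable_bound[OF integrable_divide[OF FH, of ?c]]) (auto simp: norm_mult norm_divide)
    have "fourier R \<omega> = (LINT x|lborel. cis (- \<omega> \<bullet> (- x)) * fourier H (- x) / ?c)"
      by (simp add: fourier_lborel[OF Rm]) (simp add: R_def)
    also have "\<dots> = (LINT x|lborel. cis (- \<omega> \<bullet> x) * fourier H x / ?c)"
      by (rule lborel_integral_reflect(2)[OF J])
    also have "\<dots> = fourier (fourier H) (- \<omega>) / ?c"
      by (simp add: fourier_lborel[OF FHm])
    finally show ?thesis .
  qed
  have C: "integrable lebesgue (convolve \<kappa> R)" by (rule integrable_convolve[OF \<kappa> R])
  have L: "integrable lebesgue (\<lambda>x. l * R x + convolve \<kappa> R x)" using R C by simp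
  have D: "integrable lebesgue (\<lambda>x. (-1) * q x + (l * R x + convolve \<kappa> R x))" using L q by simp
  have "AE \<omega> in lebesgue. fourier (\<lambda>x. (-1) * q x + (l * R x + convolve \<kappa> R x)) \<omega> = 0"
    using inv
  proof eventually_elim
    case (elim \<omega>)
    have "fourier (\<lambda>x. (-1) * q x + (l * R x + convolve \<kappa> R x)) \<omega> = (l + fourier \<kappa> \<omega>) * H \<omega> - fourier q \<omega>"
      unfolding fourier_linear[OF q L] fourier_linear[OF R C] fourier_convolve[OF \<kappa> R] FR elim[symmetric]
      by (simp add: distrib_right)
    then show ?case using nz by (simp add: H_def)
  qed
  from fourier_injective[OF D this] show "AE x in lebesgue. l * R x + convolve \<kappa> R x = q x"
    by eventually_elim simp
qed

section \<open>The quadratic-phase transform as a dilated Fourier transform\<close>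

definition qp_space_phase :: "('n::finite \<Rightarrow> qp_param) \<Rightarrow> real^'n \<Rightarrow> real" where
  "qp_space_phase \<Lambda> x = (\<Sum>j\<in>UNIV. pa (\<Lambda> j) * (x $ j)\<^sup>2 + pd (\<Lambda> j) * x $ j)"

definition qp_freq_phase :: "('n::finite \<Rightarrow> qp_param) \<Rightarrow> real^'n \<Rightarrow> real" where
  "qp_freq_phase \<Lambda> \<omega> = (\<Sum>j\<in>UNIV. pc (\<Lambda> j) * (\<omega> $ j)\<^sup>2 + pe (\<Lambda> j) * \<omega> $ j)"

definition qp_dilation :: "('n::finite \<Rightarrow> qp_param) \<Rightarrow> real^'n \<Rightarrow> real^'n" where
  "qp_dilation \<Lambda> \<omega> = (\<chi> j. pb (\<Lambda> j) * \<omega> $ j)"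

definition qp_amplitude :: "('n::finite \<Rightarrow> qp_param) \<Rightarrow> complex" where
  "qp_amplitude \<Lambda> = (\<Prod>j\<in>UNIV. csqrt (of_real (pb (\<Lambda> j)) / (2 * of_real pi * \<i>)))"

definition qp_inv_amplitude :: "('n::finite \<Rightarrow> qp_param) \<Rightarrow> complex" where
  "qp_inv_amplitude \<Lambda> = (\<Prod>j\<in>UNIV. csqrt (of_real (pb (\<Lambda> j)) * \<i> / (2 * of_real pi)))"

lemma measurable_qp_phase[measurable]:
  "qp_space_phase \<Lambda> \<in> borel_measurable borel" "qp_freq_phase \<Lambda> \<in> borel_measurable borel"
  unfolding qp_space_phase_def[abs_def] qp_freq_phase_def[abs_def]
  by (intro borel_measurable_continuous_onI continuous_intros)+

lemma sum_qp_phase: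
  "(\<Sum>j\<in>UNIV. qp_phase (\<Lambda> j) (\<omega> $ j) (x $ j))
     = qp_freq_phase \<Lambda> \<omega> + qp_space_phase \<Lambda> x + qp_dilation \<Lambda> \<omega> \<bullet> x"
  unfolding qp_phase_def qp_freq_phase_def qp_space_phase_def qp_dilation_def inner_vec_def
  by (simp add: sum.distrib algebra_simps)

lemma qp_kernel_factor:
  "qp_kernel \<Lambda> \<omega> x = qp_amplitude \<Lambda> * cis (qp_freq_phase \<Lambda> \<omega>) * cis (qp_space_phase \<Lambda> x) * cis (qp_dilation \<Lambda> \<omega> \<bullet> x)"
proof -
  have "qp_kernel \<Lambda> \<omega> x = qp_amplitude \<Lambda> * cis (\<Sum>j\<in>UNIV. qp_phase (\<Lambda> j) (\<omega> $ j) (x $ j))"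
    unfolding qp_kernel_def qp_amplitude_def prod.distrib cis_conv_exp
    by (simp add: exp_sum sum_distrib_left)
  then show ?thesis by (simp add: sum_qp_phase mult.assoc cis_mult)
qed

lemma qp_inv_kernel_factor:
  "qp_inv_kernel \<Lambda> \<omega> x = qp_inv_amplitude \<Lambda> * cis (- qp_freq_phase \<Lambda> \<omega>) * cis (- qp_space_phase \<Lambda> x) * cis (- (qp_dilation \<Lambda> \<omega> \<bullet> x))"
proof -
  have "qp_inv_kernel \<Lambda> \<omega> x = qp_inv_amplitude \<Lambda> * cis (- (\<Sum>j\<in>UNIV. qp_phase (\<Lambda> j) (\<omega> $ j) (x $ j)))"
    unfolding qp_inv_kernel_def qp_inv_amplitude_def prod.distrib cis_conv_exp
    by (simp add: exp_sum sum_distrib_left flip: sum_negf)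
  then show ?thesis by (simp add: sum_qp_phase mult.assoc cis_mult)
qed

lemma csqrt_of_real_mult:
  assumes "r \<ge> 0"
  shows "csqrt (of_real r * z) = of_real (sqrt r) * csqrt z"
proof (rule csqrt_unique)
  show "(of_real (sqrt r) * csqrt z)\<^sup>2 = of_real r * z"
    using assms by (simp add: power_mult_distrib flip: of_real_power)
  show "0 < Re (of_real (sqrt r) * csqrt z) \<or> Re (of_real (sqrt r) * csqrt z) = 0 \<and> 0 \<le> Im (of_real (sqrt r) * csqrt z)"
    using csqrt_principal[of z] assms by (cases "r = 0") auto
qed

text \<open>The two radicands are conjugate to each other and purely imaginary, so their principal roots are
  conjugate, whatever the sign of \<open>b\<^sub>j\<close>, and multiply to the modulus.\<close>

lemma qp_amplitude_mult_inv:
  "qp_amplitude \<Lambda> * qp_inv_amplitude \<Lambda> = of_real ((\<Prod>j\<in>UNIV. \<bar>pb (\<Lambda> j)\<bar>) / (2 * pi) ^ CARD('n))"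
  for \<Lambda> :: "'n::finite \<Rightarrow> qp_param"
proof -
  have "csqrt (of_real b / (2 * of_real pi * \<i>)) * csqrt (of_real b * \<i> / (2 * of_real pi)) = of_real (\<bar>b\<bar> / (2 * pi))" for b
  proof -
    have 1: "of_real b / (2 * of_real pi * \<i>) = of_real (\<bar>b\<bar> / (2 * pi)) * (if b < 0 then \<i> else - \<i>)"
      and 2: "of_real b * \<i> / (2 * of_real pi) = of_real (\<bar>b\<bar> / (2 * pi)) * (if b < 0 then - \<i> else \<i>)"
      by (auto simp: field_simps)
    have "csqrt \<i> * csqrt (- \<i>) = 1"
      by (simp add: complex_eq_iff real_sqrt_divide real_div_sqrt)
    then show ?thesis
      unfolding 1 2
      by (subst csqrt_of_real_mult, simp)+ (simp add: mult_ac flip: of_real_mult)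
  qed
  then show ?thesis
    unfolding qp_amplitude_def qp_inv_amplitude_def prod.distrib[symmetric]
    by (simp add: prod_dividef)
qed

lemma C_const_eq_amplitude:
  "C_const \<Lambda> = of_real (sqrt (2 * pi)) ^ CARD('n) * qp_amplitude \<Lambda>" for \<Lambda> :: "'n::finite \<Rightarrow> qp_param"
proof -
  have "csqrt (of_real b / \<i>) = of_real (sqrt (2 * pi)) * csqrt (of_real b / (2 * of_real pi * \<i>))" for b
    by (subst csqrt_of_real_mult[symmetric]) auto
  then show ?thesis unfolding C_const_def qp_amplitude_def by (simp add: prod.distrib)
qed

lemma C_const_scale_param:
  "C_const (scale_param (\<mu>\<^sup>2) \<Lambda>) = of_real (\<bar>\<mu>\<bar> ^ CARD('n)) * C_const \<Lambda>" for \<Lambda> :: "'n::finite \<Rightarrow> qp_param"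
proof -
  have "csqrt (of_real (\<mu>\<^sup>2 * b) / \<i>) = of_real \<bar>\<mu>\<bar> * csqrt (of_real b / \<i>)" for b
  proof -
    have "of_real (\<mu>\<^sup>2 * b) / \<i> = of_real (\<mu>\<^sup>2) * (of_real b / \<i>)" by simp
    then show ?thesis by (simp only: csqrt_of_real_mult[OF zero_le_power2] real_sqrt_abs)
  qed
  then show ?thesis unfolding C_const_def scale_param_def by (simp add: prod.distrib)
qed

lemma qpft_eq_fourier:
  "qpft \<Lambda> f \<omega> = qp_amplitude \<Lambda> * cis (qp_freq_phase \<Lambda> \<omega>)
     * fourier (\<lambda>x. cis (qp_space_phase \<Lambda> x) * f x) (qp_dilation \<Lambda> \<omega>)"
  unfolding qpft_def qp_kernel_factor fourier_def
  by (subst integral_mult_right_zero[symmetric]) (simp add: mult_ac)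

lemma inv_qpft_eq_integral:
  "inv_qpft \<Lambda> F x = qp_inv_amplitude \<Lambda> * cis (- qp_space_phase \<Lambda> x)
     * (LINT \<omega>|lebesgue. cis (- (qp_dilation \<Lambda> \<omega> \<bullet> x)) * (cis (- qp_freq_phase \<Lambda> \<omega>) * F \<omega>))"
  unfolding inv_qpft_def qp_inv_kernel_factor
  by (subst integral_mult_right_zero[symmetric]) (simp add: mult_ac)

text \<open>Here the chirp of the convolution contains only the quadratic part of the phase, while \<open>\<psi>\<close> also
  contains the linear part. The linear part is a character, and a character can be pulled through a
  convolution; including it makes the same \<open>\<psi>\<close> serve the convolution and the transform.\<close>

lemma otimes_conv_eq_convolve:
  "otimes_conv \<Lambda> f g x = qp_amplitude \<Lambda> * cis (- qp_space_phase \<Lambda> x)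
     * convolve (\<lambda>y. cis (qp_space_phase \<Lambda> y) * f y) (\<lambda>y. cis (qp_space_phase \<Lambda> y) * g y) x"
  for \<Lambda> :: "'n::finite \<Rightarrow> qp_param"
proof -
  let ?a = "\<lambda>y. \<Sum>j\<in>UNIV. pa (\<Lambda> j) * (y $ j)\<^sup>2"
  let ?d = "\<lambda>y. \<Sum>j\<in>UNIV. pd (\<Lambda> j) * y $ j"
  have phase: "qp_space_phase \<Lambda> y = ?a y + ?d y" for y
    by (simp add: qp_space_phase_def sum.distrib)
  have split: "?d x = ?d \<tau> + ?d (x - \<tau>)" for \<tau>
    by (simp add: algebra_simps flip: sum.distrib)
  have chirp: "chirp \<Lambda> y = cis (?a y)" for y
    by (simp add: chirp_def cis_conv_exp)
  have "cis (qp_space_phase \<Lambda> \<tau>) * f \<tau> * (cis (qp_space_phase \<Lambda> (x - \<tau>)) * g (x - \<tau>))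
      = cis (?d x) * (f \<tau> * chirp \<Lambda> \<tau> * (g (x - \<tau>) * chirp \<Lambda> (x - \<tau>)))" for \<tau>
    unfolding phase split[of \<tau>] chirp by (simp only: cis_mult[symmetric] mult_ac)
  then have "convolve (\<lambda>y. cis (qp_space_phase \<Lambda> y) * f y) (\<lambda>y. cis (qp_space_phase \<Lambda> y) * g y) x
      = cis (?d x) * (LINT \<tau>|lebesgue. f \<tau> * chirp \<Lambda> \<tau> * (g (x - \<tau>) * chirp \<Lambda> (x - \<tau>)))"
    unfolding convolve_def by (simp only: integral_mult_right_zero)
  moreover have "cis (- qp_space_phase \<Lambda> x) * cis (?d x) = exp (- \<i> * of_real (?a x))"
    unfolding phase by (simp add: cis_mult) (simp add: cis_conv_exp)
  ultimately show ?thesis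
    unfolding otimes_conv_def star_conv_def C_const_eq_amplitude by simp
qed

lemma qp_phase_scale_param:
  "qp_space_phase (scale_param s \<Lambda>) x = s * qp_space_phase \<Lambda> x"
  "qp_freq_phase (scale_param s \<Lambda>) x = s * qp_freq_phase \<Lambda> x"
  unfolding qp_space_phase_def qp_freq_phase_def scale_param_def
  by (simp_all add: sum_distrib_left algebra_simps)

lemma omega_factor_eq: "omega_factor \<Lambda> \<omega> = cis (- qp_freq_phase \<Lambda> \<omega>)"
  by (simp add: omega_factor_def qp_freq_phase_def cis_conv_exp)

lemma omega_mu_factor_eq: "omega_mu_factor \<Lambda> \<mu> = omega_factor (scale_param (\<mu>\<^sup>2) \<Lambda>)"
  unfolding fun_eq_iff omega_factor_eq qp_phase_scale_param
  by (simp add: omega_mu_factor_def qp_freq_phase_def cis_conv_exp)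

text \<open>The factor \<open>\<bar>\<mu>\<bar>\<^sup>N\<close> in the second convolution is what turns \<open>C_const \<Lambda>\<close> into the constant of \<open>\<mu>\<^sup>2 \<Lambda>\<close>.\<close>

lemma otimes_mu_conv_eq: "otimes_mu_conv \<Lambda> \<mu> = otimes_conv (scale_param (\<mu>\<^sup>2) \<Lambda>)"
  for \<Lambda> :: "'n::finite \<Rightarrow> qp_param"
proof (intro ext)
  fix f g and x :: "real^'n"
  have "mu_chirp \<Lambda> \<mu> y = cis (qp_space_phase (scale_param (\<mu>\<^sup>2) \<Lambda>) y)" for y
    unfolding qp_phase_scale_param by (simp add: mu_chirp_def qp_space_phase_def cis_conv_exp)
  moreover have "of_real (\<bar>\<mu>\<bar> ^ CARD('n)) * C_const \<Lambda> = of_real (sqrt (2 * pi)) ^ CARD('n) * qp_amplitude (scale_param (\<mu>\<^sup>2) \<Lambda>)"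
    by (simp only: C_const_scale_param[symmetric] C_const_eq_amplitude[of "scale_param (\<mu>\<^sup>2) \<Lambda>"])
  ultimately show "otimes_mu_conv \<Lambda> \<mu> f g x = otimes_conv (scale_param (\<mu>\<^sup>2) \<Lambda>) f g x"
    unfolding otimes_conv_eq_convolve otimes_mu_conv_def star_conv_def convolve_def
    by (simp only: cis_inverse mult_ac) simp
qed

lemma admissible_imp_chirp_triple:
  assumes "admissible \<Lambda> conv Q Qinv \<Omega>" "\<And>j. pb (\<Lambda> j) \<noteq> 0"
  obtains M where "\<And>j. pb (M j) \<noteq> 0" "conv = otimes_conv M" "Q = qpft M" "Qinv = inv_qpft M" "\<Omega> = omega_factor M"
proof (cases "conv = otimes_conv \<Lambda> \<and> Q = qpft \<Lambda> \<and> Qinv = inv_qpft \<Lambda> \<and> \<Omega> = omega_factor \<Lambda>")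
  case True
  then show ?thesis using assms(2) that by blast
next
  case False
  then obtain \<mu> where \<mu>: "\<mu> \<noteq> 0" "conv = otimes_mu_conv \<Lambda> \<mu>" "Q = qpft (scale_param (\<mu>\<^sup>2) \<Lambda>)"
    "Qinv = inv_qpft (scale_param (\<mu>\<^sup>2) \<Lambda>)" "\<Omega> = omega_mu_factor \<Lambda> \<mu>"
    using assms(1) unfolding admissible_def by blast
  have "pb (scale_param (\<mu>\<^sup>2) \<Lambda> j) \<noteq> 0" for j
    using \<mu>(1) assms(2)[of j] by (simp add: scale_param_def)
  then show ?thesis
    using \<mu>(2-) unfolding otimes_mu_conv_eq omega_mu_factor_eq by (rule that)
qed

section \<open>Dilation of the frequency variable\<close>

lemma measurable_qp_dilation[measurable]: "qp_dilation \<Lambda> \<in> borel \<rightarrow>\<^sub>M borel"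
  unfolding qp_dilation_def[abs_def] by (intro borel_measurable_continuous_onI continuous_intros)

lemma surj_qp_dilation:
  assumes "\<And>j. pb (\<Lambda> j) \<noteq> 0"
  obtains \<eta> where "\<omega> = qp_dilation \<Lambda> \<eta>"
  by (rule that[of "\<chi> j. \<omega> $ j / pb (\<Lambda> j)"]) (simp add: qp_dilation_def vec_eq_iff assms)

lemma lborel_qp_dilation:
  fixes \<Lambda> :: "'n::finite \<Rightarrow> qp_param"
  assumes "\<And>j. pb (\<Lambda> j) \<noteq> 0"
  shows "(lborel :: (real^'n) measure) = density (distr lborel borel (qp_dilation \<Lambda>)) (\<lambda>_. ennreal (\<Prod>j\<in>UNIV. \<bar>pb (\<Lambda> j)\<bar>))"
proof -
  define c :: "real^'n \<Rightarrow> real" where "c e = (\<chi> j. pb (\<Lambda> j)) \<bullet> e" for e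
  have c_axis: "c (axis i 1) = pb (\<Lambda> i)" for i by (simp add: c_def inner_axis)
  have B: "(Basis :: (real^'n) set) = (\<lambda>i. axis i 1) ` UNIV"
    by (auto simp: Basis_vec_def)
  have inj: "inj (\<lambda>i::'n. axis i (1::real))" by (auto intro!: injI simp: axis_eq_axis)
  have c0: "c e \<noteq> 0" if "e \<in> Basis" for e using that assms by (auto simp: B c_axis)
  have T: "0 + (\<Sum>e\<in>Basis. (c e * (x \<bullet> e)) *\<^sub>R e) = qp_dilation \<Lambda> x" for x
    unfolding B sum.reindex[OF inj] o_def c_axis inner_axis
    by (simp add: vec_eq_iff qp_dilation_def axis_def if_distrib cong: if_cong)
  have P: "(\<Prod>e\<in>Basis. \<bar>c e\<bar>) = (\<Prod>j\<in>UNIV. \<bar>pb (\<Lambda> j)\<bar>)"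
    unfolding B prod.reindex[OF inj] by (simp add: c_axis)
  show ?thesis using lborel_affine_euclidean[of c 0] c0 unfolding T P by simp
qed

lemma qp_dilation_integral:
  fixes f :: "real^'n::finite \<Rightarrow> complex"
  assumes b: "\<And>j. pb (\<Lambda> j) \<noteq> 0" and f[measurable]: "f \<in> borel_measurable borel"
  shows "integrable lborel (\<lambda>\<omega>. f (qp_dilation \<Lambda> \<omega>)) \<longleftrightarrow> integrable lborel f"
    and "(LINT \<omega>|lborel. f (qp_dilation \<Lambda> \<omega>)) = (LINT \<omega>|lborel. f \<omega>) / of_real (\<Prod>j\<in>UNIV. \<bar>pb (\<Lambda> j)\<bar>)"
proof -
  define c where "c = (\<Prod>j\<in>UNIV. \<bar>pb (\<Lambda> j)\<bar>)"
  have c: "c > 0" unfolding c_def using b by (intro prod_pos) auto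
  note eq = lborel_qp_dilation[where \<Lambda>=\<Lambda>, OF b, folded c_def]
  have "integrable lborel f \<longleftrightarrow> integrable lborel (\<lambda>\<omega>. c *\<^sub>R f (qp_dilation \<Lambda> \<omega>))"
    by (subst (1) eq, subst integrable_density) (use c in \<open>auto simp: integrable_distr_eq\<close>)
  then show "integrable lborel (\<lambda>\<omega>. f (qp_dilation \<Lambda> \<omega>)) \<longleftrightarrow> integrable lborel f"
    using c by (simp add: integrable_scaleR_iff)
  have "(LINT \<omega>|lborel. f \<omega>) = c *\<^sub>R (LINT \<omega>|lborel. f (qp_dilation \<Lambda> \<omega>))"
    by (subst (1) eq, subst integral_density) (use c in \<open>auto simp: integral_distr\<close>)
  then show "(LINT \<omega>|lborel. f (qp_dilation \<Lambda> \<omega>)) = (LINT \<omega>|lborel. f \<omega>) / of_real (\<Prod>j\<in>UNIV. \<bar>pb (\<Lambda> j)\<bar>)"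
    unfolding c_def[symmetric] using c by (simp add: scaleR_conv_of_real)
qed

lemma lebesgue_integral_qp_dilation:
  fixes H :: "real^'n::finite \<Rightarrow> complex"
  assumes b: "\<And>j. pb (\<Lambda> j) \<noteq> 0" and H[measurable]: "H \<in> borel_measurable borel"
  shows "integrable lebesgue (\<lambda>\<omega>. H (qp_dilation \<Lambda> \<omega>)) \<longleftrightarrow> integrable lebesgue H"
    and "(LINT \<omega>|lebesgue. cis (- (qp_dilation \<Lambda> \<omega> \<bullet> x)) * H (qp_dilation \<Lambda> \<omega>))
      = fourier H (- x) / of_real (\<Prod>j\<in>UNIV. \<bar>pb (\<Lambda> j)\<bar>)"
proof -
  show "integrable lebesgue (\<lambda>\<omega>. H (qp_dilation \<Lambda> \<omega>)) \<longleftrightarrow> integrable lebesgue H"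
    using qp_dilation_integral(1)[where \<Lambda>=\<Lambda>, OF b H] by (simp add: integrable_completion)
  have "(LINT \<omega>|lebesgue. cis (- (qp_dilation \<Lambda> \<omega> \<bullet> x)) * H (qp_dilation \<Lambda> \<omega>))
      = (LINT \<omega>|lborel. cis (- (qp_dilation \<Lambda> \<omega> \<bullet> x)) * H (qp_dilation \<Lambda> \<omega>))"
    by (rule integral_completion) measurable
  also have "\<dots> = (LINT \<omega>|lborel. cis (- (\<omega> \<bullet> x)) * H \<omega>) / of_real (\<Prod>j\<in>UNIV. \<bar>pb (\<Lambda> j)\<bar>)"
    by (rule qp_dilation_integral(2)[where \<Lambda>=\<Lambda> and f="\<lambda>\<omega>. cis (- (\<omega> \<bullet> x)) * H \<omega>", OF b]) measurable
  also have "(LINT \<omega>|lborel. cis (- (\<omega> \<bullet> x)) * H \<omega>) = fourier H (- x)"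
    by (simp add: fourier_lborel[OF H] inner_commute)
  finally show "(LINT \<omega>|lebesgue. cis (- (qp_dilation \<Lambda> \<omega> \<bullet> x)) * H (qp_dilation \<Lambda> \<omega>))
      = fourier H (- x) / of_real (\<Prod>j\<in>UNIV. \<bar>pb (\<Lambda> j)\<bar>)" .
qed

section \<open>Convolution equations for the quadratic-phase transform\<close>

lemma integrable_lebesgue_phase_iff:
  fixes f :: "real^'n::finite \<Rightarrow> complex"
  assumes [measurable]: "\<theta> \<in> borel_measurable borel"
  shows "integrable lebesgue (\<lambda>x. cis (\<theta> x) * f x) \<longleftrightarrow> integrable lebesgue f"
proof
  assume "integrable lebesgue (\<lambda>x. cis (\<theta> x) * f x)"
  then have "integrable lebesgue (\<lambda>x. cis (- \<theta> x) * (cis (\<theta> x) * f x))"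
    by (rule integrable_lebesgue_unimodular_mult) simp_all
  then show "integrable lebesgue f" by (simp add: cis_mult flip: mult.assoc)
next
  assume "integrable lebesgue f"
  then show "integrable lebesgue (\<lambda>x. cis (\<theta> x) * f x)"
    by (rule integrable_lebesgue_unimodular_mult) simp_all
qed

text \<open>Multiplying the equation by the unimodular function \<open>\<psi>\<close> changes neither integrability nor the
  solution set and leaves an equation for \<open>\<psi> \<phi>\<close> with the plain convolution.\<close>

lemma L1_solution_otimes_conv_iff:
  "L1_solution (otimes_conv \<Lambda>) l k p \<phi> \<longleftrightarrow>
     integrable lebesgue (\<lambda>x. cis (qp_space_phase \<Lambda> x) * \<phi> x) \<and>
     (AE x in lebesgue. l * (cis (qp_space_phase \<Lambda> x) * \<phi> x)
        + convolve (\<lambda>y. qp_amplitude \<Lambda> * (cis (qp_space_phase \<Lambda> y) * k y)) (\<lambda>y. cis (qp_space_phase \<Lambda> y) * \<phi> y) x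
        = cis (qp_space_phase \<Lambda> x) * p x)"
proof -
  let ?\<psi> = "\<lambda>x. cis (qp_space_phase \<Lambda> x)"
  have pull: "convolve (\<lambda>y. qp_amplitude \<Lambda> * (?\<psi> y * k y)) (\<lambda>y. ?\<psi> y * \<phi> y) x
      = qp_amplitude \<Lambda> * convolve (\<lambda>y. ?\<psi> y * k y) (\<lambda>y. ?\<psi> y * \<phi> y) x" for x
    unfolding convolve_def mult.assoc by (rule integral_mult_right_zero)
  have "?\<psi> x * cis (- qp_space_phase \<Lambda> x) = 1" for x by (simp add: cis_mult)
  then have "l * (?\<psi> x * \<phi> x) + qp_amplitude \<Lambda> * c = ?\<psi> x * (l * \<phi> x + qp_amplitude \<Lambda> * cis (- qp_space_phase \<Lambda> x) * c)" for x c
    by (simp add: algebra_simps)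
  then show ?thesis
    unfolding L1_solution_def pull otimes_conv_eq_convolve
    by (simp add: integrable_lebesgue_phase_iff[OF measurable_qp_phase(1)])
qed

theorem theorem6p1:
  fixes \<Lambda> :: "'n::finite \<Rightarrow> qp_param"
    and conv :: "(real^'n \<Rightarrow> complex) \<Rightarrow> (real^'n \<Rightarrow> complex) \<Rightarrow> real^'n \<Rightarrow> complex"
    and Q Qinv :: "(real^'n \<Rightarrow> complex) \<Rightarrow> real^'n \<Rightarrow> complex"
    and \<Omega> S k p :: "real^'n \<Rightarrow> complex"
    and l :: complex
  assumes "\<And>j. pb (\<Lambda> j) \<noteq> 0"
    and "admissible \<Lambda> conv Q Qinv \<Omega>"
    and "integrable lebesgue k"
    and "integrable lebesgue p"
    and "\<And>\<omega>. S \<omega> = l + \<Omega> \<omega> * Q k \<omega>"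
    and "\<And>\<omega>. S \<omega> \<noteq> 0"
    and "integrable lebesgue (\<lambda>\<omega>. Q p \<omega> / S \<omega>)"
  shows "((\<exists>\<phi>. L1_solution conv l k p \<phi>)
            \<longleftrightarrow> integrable lebesgue (Qinv (\<lambda>\<omega>. Q p \<omega> / S \<omega>)))
       \<and> (integrable lebesgue (Qinv (\<lambda>\<omega>. Q p \<omega> / S \<omega>)) \<longrightarrow>
            L1_solution conv l k p (Qinv (\<lambda>\<omega>. Q p \<omega> / S \<omega>))
            \<and> (\<forall>\<phi>. L1_solution conv l k p \<phi>
                  \<longrightarrow> (AE x in lebesgue. \<phi> x = Qinv (\<lambda>\<omega>. Q p \<omega> / S \<omega>) x)))"
proof -
  obtain M where b: "\<And>j. pb (M j) \<noteq> 0" and triple: "conv = otimes_conv M" "Q = qpft M" "Qinv = inv_qpft M" "\<Omega> = omega_factor M"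
    using admissible_imp_chirp_triple[OF assms(2,1)] by blast
  define \<psi> where "\<psi> x = cis (qp_space_phase M x)" for x
  define A where "A = qp_amplitude M"
  define \<kappa> where "\<kappa> = (\<lambda>x. A * (\<psi> x * k x))"
  define q where "q = (\<lambda>x. \<psi> x * p x)"
  define H where "H \<omega> = fourier q \<omega> / (l + fourier \<kappa> \<omega>)" for \<omega>
  define R where "R x = fourier H (- x) / of_real ((2 * pi) ^ CARD('n))" for x
  define F where "F \<omega> = Q p \<omega> / S \<omega>" for \<omega>
  have A0: "A \<noteq> 0" using b by (simp add: A_def qp_amplitude_def)
  have \<psi>_inv: "cis (- qp_space_phase M x) * \<psi> x = 1" "\<psi> x \<noteq> 0" for x
    by (simp_all add: \<psi>_def cis_mult)
  have \<psi>k: "integrable lebesgue (\<lambda>x. \<psi> x * k x)" and q: "integrable lebesgue q"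
    using assms(3,4) by (simp_all add: \<psi>_def q_def integrable_lebesgue_phase_iff)
  then have \<kappa>: "integrable lebesgue \<kappa>" by (simp add: \<kappa>_def)
  have F\<kappa>: "fourier \<kappa> \<eta> = A * fourier (\<lambda>x. \<psi> x * k x) \<eta>" for \<eta>
    using fourier_linear[OF \<psi>k, of "\<lambda>_. 0" A] by (simp add: \<kappa>_def) (simp add: fourier_def)
  have S: "S \<omega> = l + fourier \<kappa> (qp_dilation M \<omega>)" for \<omega>
    unfolding assms(5) triple omega_factor_eq qpft_eq_fourier F\<kappa> A_def \<psi>_def
    by (simp add: cis_mult flip: mult.assoc)
  \<comment> \<open>Every frequency is dilated from some \<open>\<omega>\<close> because no \<open>b\<^sub>j\<close> vanishes.\<close>
  have nz: "l + fourier \<kappa> \<eta> \<noteq> 0" for \<eta>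
    using surj_qp_dilation[of M \<eta>, OF b] assms(6) S by metis
  \<comment> \<open>The phase \<open>qp_freq_phase\<close> in the numerator \<open>Q p\<close> is the one that the inverse kernel removes.\<close>
  have F_eq: "cis (- qp_freq_phase M \<omega>) * F \<omega> = A * H (qp_dilation M \<omega>)" for \<omega>
    unfolding F_def H_def S triple qpft_eq_fourier A_def q_def \<psi>_def
    by (simp add: mult_ac cis_mult flip: mult.assoc)
  have Hm: "H \<in> borel_measurable borel"
    using measurable_fourier[OF \<kappa>] measurable_fourier[OF q] unfolding H_def[abs_def] by measurable
  have "integrable lebesgue (\<lambda>\<omega>. cis (- qp_freq_phase M \<omega>) * F \<omega>)"
    using assms(7) unfolding F_def by (subst integrable_lebesgue_phase_iff) simp_all
  then have "integrable lebesgue (\<lambda>\<omega>. inverse A * (A * H (qp_dilation M \<omega>)))"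
    unfolding F_eq by (rule integrable_mult_right)
  then have "integrable lebesgue (\<lambda>\<omega>. H (qp_dilation M \<omega>))"
    using A0 by (simp flip: mult.assoc)
  then have H: "integrable lebesgue H"
    by (simp add: lebesgue_integral_qp_dilation(1)[OF b Hm])
  \<comment> \<open>The amplitudes leave \<open>\<Prod>|b\<^sub>j| / (2\<pi>)\<^sup>N\<close>, whose numerator cancels against the Jacobian of the dilation.\<close>
  have Qinv: "Qinv F x = cis (- qp_space_phase M x) * R x" for x
  proof -
    have P: "(\<Prod>j\<in>UNIV. \<bar>pb (M j)\<bar>) \<noteq> 0" using b by simp
    have "Qinv F x = qp_inv_amplitude M * cis (- qp_space_phase M x) * (LINT \<omega>|lebesgue. A * (cis (- (qp_dilation M \<omega> \<bullet> x)) * H (qp_dilation M \<omega>)))"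
      unfolding triple inv_qpft_eq_integral F_eq by (simp only: mult.left_commute)
    also have "\<dots> = (qp_amplitude M * qp_inv_amplitude M) * cis (- qp_space_phase M x) * (fourier H (- x) / of_real (\<Prod>j\<in>UNIV. \<bar>pb (M j)\<bar>))"
      unfolding integral_mult_right_zero lebesgue_integral_qp_dilation(2)[OF b Hm] by (simp add: A_def)
    also have "\<dots> = cis (- qp_space_phase M x) * R x"
      unfolding qp_amplitude_mult_inv R_def using P by simp
    finally show ?thesis .
  qed
  then have \<psi>Qinv: "(\<lambda>x. \<psi> x * Qinv F x) = R"
    using \<psi>_inv by (simp add: fun_eq_iff mult_ac flip: mult.assoc)
  have sol: "L1_solution conv l k p \<phi> \<longleftrightarrow> integrable lebesgue (\<lambda>x. \<psi> x * \<phi> x) \<and>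
      (AE x in lebesgue. l * (\<psi> x * \<phi> x) + convolve \<kappa> (\<lambda>x. \<psi> x * \<phi> x) x = q x)" for \<phi>
    unfolding triple L1_solution_otimes_conv_iff \<kappa>_def q_def \<psi>_def A_def ..
  have Qinv_int: "integrable lebesgue (Qinv F) \<longleftrightarrow> integrable lebesgue R"
    unfolding \<psi>Qinv[symmetric] unfolding \<psi>_def by (simp add: integrable_lebesgue_phase_iff)
  have R_eq: "R = (\<lambda>x. fourier (\<lambda>\<omega>. fourier q \<omega> / (l + fourier \<kappa> \<omega>)) (- x) / of_real ((2 * pi) ^ DIM(real^'n)))"
    by (simp add: R_def[abs_def] H_def[abs_def])
  have unique: "AE x in lebesgue. \<phi> x = Qinv F x" if "L1_solution conv l k p \<phi>" for \<phi>
  proof -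
    have "AE x in lebesgue. \<psi> x * \<phi> x = R x"
      using convolution_equation_unique[OF \<kappa> q nz H[unfolded H_def[abs_def]], of "\<lambda>x. \<psi> x * \<phi> x"] that
      unfolding sol R_eq by blast
    then show ?thesis
      by eventually_elim (use \<psi>_inv(2) fun_cong[OF \<psi>Qinv] in \<open>metis mult_left_cancel\<close>)
  qed
  have exists: "L1_solution conv l k p (Qinv F)" if "integrable lebesgue (Qinv F)"
  proof -
    have R: "integrable lebesgue R" using that by (simp add: Qinv_int)
    then have "AE x in lebesgue. l * R x + convolve \<kappa> R x = q x"
      unfolding R_eq by (rule convolution_equation_solution[OF \<kappa> q nz H[unfolded H_def[abs_def]]])
    with R show ?thesis
      unfolding sol \<psi>Qinv fun_cong[OF \<psi>Qinv] by blast
  qed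
  have "integrable lebesgue (Qinv F)" if "L1_solution conv l k p \<phi>" for \<phi>
  proof -
    have \<phi>: "integrable lebesgue \<phi>" using that by (simp add: L1_solution_def)
    have "Qinv F \<in> borel_measurable lebesgue"
      by (rule borel_measurable_AE[OF borel_measurable_integrable[OF \<phi>] unique[OF that]])
    then show ?thesis
      by (rule integrable_cong_AE_imp[OF \<phi> _ unique[OF that]])
  qed
  then show ?thesis using unique exists unfolding F_def[abs_def] by blast
qed

end
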